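(* Let $(\Xi^n)_{n\ge 0}$ be generated by an edge iterated graph system satisfying the standing assumptions (canonical, distance-positive, degree-primitive, single-edge initial graph). For every $v\in V(\Xi)$, if $\rho(\mathbf N)>1$ then the local mass dimension of $\Xi$ at $v$ exists and $$\dim_{\mathrm{M,loc}}(\Xi:v)=\frac{\log\rho(\mathbf N)}{\log\rho_{\min}(\mathcal D)}.$$
   Context: **EIGS.** Fix $K\ge1$ colours $[K]=\{1,\dots,K\}$. An edge iterated graph system (EIGS) consists of finite directed rule graphs $R_1,\dots,R_K$ whose edges are coloured by a map $\mathscr C$ with values in $[K]$, each $R_i$ having two distinct planting vertices $\beta_i^+\ne\beta_i^-$, and an initial graph $\Xi^0$, which is a single directed edge of some colour with endpoints $\mathfrak v_+,\mathfrak v_-$. Given $\Xi^n$, the graph $\Xi^{n+1}$ is obtained by simultaneously replacing every directed edge $e=(a,b)$ of colour $i$ by a fresh copy of $R_i$, identifying $a\equiv\beta_i^+$, $b\equiv\beta_i^-$, with no other identifications. Thus $V(\Xi^n)\subset V(\Xi^{n+1})$, and $V(\Xi)=\bigcup_nV(\Xi^n)$. Distances $d_G$, degrees, paths and balls $B_G(v,r)=\{u:d_G(v,u)<r\}$ refer to underlying undirected graphs, which are assumed simple and connected. **Matrices.** $\mathbf N\in\mathbb N^{2K\times2K}$ has rows $\kappa_{R_1}(\beta_1^+),\kappa_{R_1}(\beta_1^-),\dots,\kappa_{R_K}(\beta_K^+),\kappa_{R_K}(\beta_K^-)$, where $[\kappa_G(v)]_{2j-1}$ (resp. $[\kappa_G(v)]_{2j}$)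 is the number of $j$-coloured edges of $G$ leaving (resp. entering) $v$. $\mathcal D$ is the finite set of $K\times K$ matrices obtained by choosing, for each $i$, a simple path in $R_i$ between $\beta_i^+$ and $\beta_i^-$ and letting the $(i,j)$ entry be the number of $j$-coloured edges on the chosen path. $\rho(\cdot)$ is the spectral radius and $\rho_{\min}(\mathcal D)=\min_{D\in\mathcal D}\rho(D)$. **Standing assumptions.** (1) Canonical: every edge of every $R_i$ lies on a simple path joining $\beta_i^+$ and $\beta_i^-$. (2) Distance-positive: all matrices in $\mathcal D$ have positive entries; if $K=1$, additionally $d_{R_1}(\beta_1^+,\beta_1^-)\ge2$. (3) $\mathbf N$ is primitive. (4) $\Xi^0$ is a single edge. **Local mass dimension.** For a constant $r_*>1$, $$\dim_{\mathrm{M,loc}}(\Xi:v)=\lim_{n\to\infty}\frac{\log|B_{\Xi^n}(v,r_* )|}{-\log\frac{r_*}{\mathrm{diam}(\Xi^n)}},$$ provided the limit exists and is independent of the choice of $r_*>1$. *)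

theory Defs
  imports
    Complex_Main
    "Graph_Theory.Digraph_Component"
    "Graph_Theory.Shortest_Path"
    "Jordan_Normal_Form.Spectral_Radius"
begin

section \<open>Underlying undirected graphs\<close>

text \<open>
  The underlying undirected graph of a digraph is rendered as the symmetric digraph in which
  every arc \<open>e\<close> may be traversed forwards as \<open>(e, True)\<close> and backwards as \<open>(e, False)\<close>. In contrast
  to \<^const>\<open>mk_symmetric\<close>, a walk still records which arcs, and hence which colours, it uses.
\<close>

definition undirected :: "('a, 'b) pre_digraph \<Rightarrow> ('a, 'b \<times> bool) pre_digraph" where
  "undirected G =
     \<lparr> verts = verts G,
       arcs = arcs G \<times> UNIV,
       tail = (\<lambda>(e, fwd). if fwd then tail G e else head G e),
       head = (\<lambda>(e, fwd). if fwd then head G e else tail G e) \<rparr>"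

definition underlying_simple :: "('a, 'b) pre_digraph \<Rightarrow> bool" where
  "underlying_simple G \<longleftrightarrow>
     loopfree_digraph G \<and> inj_on (\<lambda>e. {tail G e, head G e}) (arcs G)"

definition simple_path :: "('a, 'b) pre_digraph \<Rightarrow> 'a \<Rightarrow> ('b \<times> bool) awalk \<Rightarrow> 'a \<Rightarrow> bool" where
  "simple_path G = pre_digraph.apath (undirected G)"

definition graph_dist :: "('a, 'b) pre_digraph \<Rightarrow> 'a \<Rightarrow> 'a \<Rightarrow> ereal" where
  "graph_dist G = wf_digraph.\<mu> (undirected G) (\<lambda>_. 1)"

definition graph_ball :: "('a, 'b) pre_digraph \<Rightarrow> 'a \<Rightarrow> real \<Rightarrow> 'a set" where
  "graph_ball G v r = {u \<in> verts G. graph_dist G v u < ereal r}"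

definition graph_diam :: "('a, 'b) pre_digraph \<Rightarrow> real" where
  "graph_diam G = real_of_ereal (SUP (u, v) \<in> verts G \<times> verts G. graph_dist G u v)"


section \<open>Edge iterated graph systems\<close>

record ('a, 'b) coloured_graph =
  dgraph :: "('a, 'b) pre_digraph"
  colour :: "'b \<Rightarrow> nat"

text \<open>
  Colours are numbered \<open>0, \<dots>, K - 1\<close>, where \<open>K\<close> is the number of colours. The colour map on
  the edges of all rule graphs is given by its restriction to each rule graph.
  The initial graph is a single edge, so it is determined by the colour of that edge.
\<close>

record ('v, 'e) eigs =
  ncolours :: nat
  rule :: "nat \<Rightarrow> ('v, 'e) coloured_graph"
  plus_vertex :: "nat \<Rightarrow> 'v"
  minus_vertex :: "nat \<Rightarrow> 'v"
  init_colour :: nat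

definition valid_eigs :: "('v, 'e) eigs \<Rightarrow> bool" where
  "valid_eigs S \<longleftrightarrow>
     1 \<le> ncolours S \<and> init_colour S < ncolours S \<and>
     (\<forall>i < ncolours S.
        let R = rule S i in
          fin_digraph (dgraph R) \<and>
          underlying_simple (dgraph R) \<and>
          Digraph_Component.connected (dgraph R) \<and>
          (\<forall>e \<in> arcs (dgraph R). colour R e < ncolours S) \<and>
          plus_vertex S i \<in> verts (dgraph R) \<and>
          minus_vertex S i \<in> verts (dgraph R) \<and>
          plus_vertex S i \<noteq> minus_vertex S i)"

text \<open>
  The edges of the \<open>n\<close>-th graph are addressed by words of length \<open>n\<close>: \<open>e # w\<close> is the copy of
  the rule edge \<open>e\<close> in the copy of the rule graph that replaces the edge \<open>w\<close>. The vertex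
  \<open>Planted w x\<close> is the copy of the non-planting vertex \<open>x\<close> created when \<open>w\<close> is replaced. As
  the length of \<open>w\<close> is the stage, these vertices are fresh, and vertex sets are literally increasing.
\<close>

datatype ('v, 'e) eigs_vertex = Init_Plus | Init_Minus | Planted "'e list" 'v

definition plant ::
  "('v, 'e) eigs \<Rightarrow> (('v, 'e) eigs_vertex, 'e list) coloured_graph \<Rightarrow> 'e list \<Rightarrow> 'v
     \<Rightarrow> ('v, 'e) eigs_vertex" where
  "plant S G w x =
     (if x = plus_vertex S (colour G w) then tail (dgraph G) w
      else if x = minus_vertex S (colour G w) then head (dgraph G) w
      else Planted w x)"

definition substitute ::
  "('v, 'e) eigs \<Rightarrow> (('v, 'e) eigs_vertex, 'e list) coloured_graph
     \<Rightarrow> (('v, 'e) eigs_vertex, 'e list) coloured_graph" where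
  "substitute S G =
     (let R = (\<lambda>w. rule S (colour G w)) in
      \<lparr> dgraph =
          \<lparr> verts = verts (dgraph G) \<union>
              (\<Union>w \<in> arcs (dgraph G). plant S G w ` verts (dgraph (R w))),
            arcs = {e # w | e w. w \<in> arcs (dgraph G) \<and> e \<in> arcs (dgraph (R w))},
            tail = (\<lambda>a. plant S G (tl a) (tail (dgraph (R (tl a))) (hd a))),
            head = (\<lambda>a. plant S G (tl a) (head (dgraph (R (tl a))) (hd a))) \<rparr>,
        colour = (\<lambda>a. colour (R (tl a)) (hd a)) \<rparr>)"

primrec Xi ::
  "('v, 'e) eigs \<Rightarrow> nat \<Rightarrow> (('v, 'e) eigs_vertex, 'e list) coloured_graph" where
  "Xi S 0 =
     \<lparr> dgraph = \<lparr> verts = {Init_Plus, Init_Minus}, arcs = {[]},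
                  tail = (\<lambda>_. Init_Plus), head = (\<lambda>_. Init_Minus) \<rparr>,
       colour = (\<lambda>_. init_colour S) \<rparr>"
| "Xi S (Suc n) = substitute S (Xi S n)"

definition Xi_graph ::
  "('v, 'e) eigs \<Rightarrow> nat \<Rightarrow> (('v, 'e) eigs_vertex, 'e list) pre_digraph" where
  "Xi_graph S n = dgraph (Xi S n)"

definition Xi_verts :: "('v, 'e) eigs \<Rightarrow> ('v, 'e) eigs_vertex set" where
  "Xi_verts S = (\<Union>n. verts (Xi_graph S n))"


section \<open>Associated matrices\<close>

definition degree_vec :: "nat \<Rightarrow> ('a, 'b) coloured_graph \<Rightarrow> 'a \<Rightarrow> nat vec" where
  "degree_vec K G v = vec (2 * K) (\<lambda>c.
     if even c then card {e \<in> arcs (dgraph G). colour G e = c div 2 \<and> tail (dgraph G) e = v}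
     else card {e \<in> arcs (dgraph G). colour G e = c div 2 \<and> head (dgraph G) e = v})"

definition degree_matrix :: "('v, 'e) eigs \<Rightarrow> nat mat" where
  "degree_matrix S = mat_of_row_fun (2 * ncolours S) (2 * ncolours S) (\<lambda>r.
     let i = r div 2 in
       degree_vec (ncolours S) (rule S i)
         (if even r then plus_vertex S i else minus_vertex S i))"

definition distance_matrices :: "('v, 'e) eigs \<Rightarrow> nat mat set" where
  "distance_matrices S =
     {mat (ncolours S) (ncolours S)
        (\<lambda>(i, j). length (filter (\<lambda>(e, _). colour (rule S i) e = j) (p i))) | p.
      \<forall>i < ncolours S. simple_path (dgraph (rule S i)) (plus_vertex S i) (p i) (minus_vertex S i)}"

definition rho :: "nat mat \<Rightarrow> real" where
  "rho A = spectral_radius (map_mat of_nat A)"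

definition rho_min :: "nat mat set \<Rightarrow> real" where
  "rho_min \<D> = Min (rho ` \<D>)"

definition positive_mat :: "nat mat \<Rightarrow> bool" where
  "positive_mat A \<longleftrightarrow> (\<forall>i < dim_row A. \<forall>j < dim_col A. 0 < A $$ (i, j))"

definition primitive_mat :: "nat mat \<Rightarrow> bool" where
  "primitive_mat A \<longleftrightarrow> square_mat A \<and> (\<exists>k \<ge> 1. positive_mat (A ^\<^sub>m k))"


section \<open>Standing assumptions\<close>

definition canonical :: "('v, 'e) eigs \<Rightarrow> bool" where
  "canonical S \<longleftrightarrow>
     (\<forall>i < ncolours S. \<forall>e \<in> arcs (dgraph (rule S i)).
        \<exists>p. simple_path (dgraph (rule S i)) (plus_vertex S i) p (minus_vertex S i) \<and>
            e \<in> fst ` set p)"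

definition distance_positive :: "('v, 'e) eigs \<Rightarrow> bool" where
  "distance_positive S \<longleftrightarrow>
     (\<forall>D \<in> distance_matrices S. positive_mat D) \<and>
     (ncolours S = 1 \<longrightarrow>
        2 \<le> graph_dist (dgraph (rule S 0)) (plus_vertex S 0) (minus_vertex S 0))"


section \<open>Local mass dimension\<close>

text \<open>
  The value \<open>d\<close> is the limit for every radius \<open>r > 1\<close>, which expresses both existence of the limit and
  its independence of the radius.
\<close>

definition has_local_mass_dim ::
  "(nat \<Rightarrow> ('a, 'b) pre_digraph) \<Rightarrow> 'a \<Rightarrow> real \<Rightarrow> bool" where
  "has_local_mass_dim G v d \<longleftrightarrow>
     (\<forall>r > 1. (\<lambda>n. ln (real (card (graph_ball (G n) v r))) / (- ln (r / graph_diam (G n))))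
                \<longlonglongrightarrow> d)"

definition local_mass_dim_exists :: "(nat \<Rightarrow> ('a, 'b) pre_digraph) \<Rightarrow> 'a \<Rightarrow> bool" where
  "local_mass_dim_exists G v \<longleftrightarrow> (\<exists>d. has_local_mass_dim G v d)"

definition local_mass_dim :: "(nat \<Rightarrow> ('a, 'b) pre_digraph) \<Rightarrow> 'a \<Rightarrow> real" where
  "local_mass_dim G v = (THE d. has_local_mass_dim G v d)"

end

theory Submission
  imports Defs
begin

text \<open>
  Let \<open>\<rho>\<close> be the minimal spectral radius of a distance matrix and \<open>u\<close> the Perron vector of a minimiser.
  As all distance matrices are positive, exchanging a row for a cheaper path would lower the spectral
  radius, so in every rule graph \<open>R\<^sub>i\<close>, with edges of colour \<open>j\<close> weighted by \<open>u\<^sub>j\<close>, the planting vertices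
  have distance exactly \<open>\<rho> u\<^sub>i\<close>. Hence weighted distances between old vertices grow by the exact factor
  \<open>\<rho>\<close> in every step. Lower bounds come from extending Lipschitz potentials from one level to
  the next, upper bounds from substituting walks; together they give \<open>diam(\<Xi>\<^sup>n) \<asymp> \<rho>\<^sup>n\<close>. A potential that
  vanishes only at \<open>v\<close> shows that a ball around \<open>v\<close> of fixed radius stays inside the copies of the
  edges that were incident to \<open>v\<close> a bounded number of levels earlier, so its size is comparable to
  the degree of \<open>v\<close>. Weighting degrees with the Perron vector of the degree matrix \<open>N\<close> makes them grow
  by the exact factor \<open>\<rho>(N)\<close>.
\<close>

section \<open>Perron vectors\<close>

lemma mult_mat_vec_entry:
  assumes "A \<in> carrier_mat n m" "v \<in> carrier_vec m" "i < n"
  shows "(A *\<^sub>v v) $ i = (\<Sum>j<m. A $$ (i, j) * v $ j)"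
  using assms by (simp add: scalar_prod_def atLeast0LessThan)

lemma pow_mat_Suc_entry:
  fixes A :: "'a::semiring_1 mat"
  assumes "A \<in> carrier_mat n n" "i < n" "j < n"
  shows "(A ^\<^sub>m Suc k) $$ (i, j) = (\<Sum>l<n. (A ^\<^sub>m k) $$ (i, l) * A $$ (l, j))"
  using assms pow_carrier_mat[OF assms(1), of k]
  by (simp add: scalar_prod_def atLeast0LessThan)

text \<open>Powers are defined by multiplication from the right. Splitting off the left factor as
  well gives that a matrix commutes with its powers.\<close>

lemma pow_mat_Suc_entry':
  fixes A :: "'a::comm_semiring_1 mat"
  assumes "A \<in> carrier_mat n n" "i < n" "j < n"
  shows "(A ^\<^sub>m Suc k) $$ (i, j) = (\<Sum>l<n. A $$ (i, l) * (A ^\<^sub>m k) $$ (l, j))"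
  using assms(2,3)
proof (induction k arbitrary: i j)
  case 0
  with assms(1) have "(A ^\<^sub>m Suc 0) $$ (i, j) = A $$ (i, j)" by simp
  also have "\<dots> = (\<Sum>l<n. A $$ (i, l) * (1\<^sub>m n) $$ (l, j))"
    using 0 by (simp add: if_distrib[where f="\<lambda>x. _ * x"] sum.delta cong: if_cong)
  finally show ?case using assms(1) by simp
next
  case (Suc k)
  have "(A ^\<^sub>m Suc (Suc k)) $$ (i, j) = (\<Sum>l<n. (A ^\<^sub>m Suc k) $$ (i, l) * A $$ (l, j))"
    using pow_mat_Suc_entry[OF assms(1) Suc.prems] .
  also have "\<dots> = (\<Sum>l<n. (\<Sum>h<n. A $$ (i, h) * (A ^\<^sub>m k) $$ (h, l)) * A $$ (l, j))"
    using Suc by (intro sum.cong) (auto simp del: pow_mat.simps)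
  also have "\<dots> = (\<Sum>h<n. A $$ (i, h) * (\<Sum>l<n. (A ^\<^sub>m k) $$ (h, l) * A $$ (l, j)))"
    unfolding sum_distrib_left sum_distrib_right by (subst sum.swap) (simp add: mult.assoc)
  also have "\<dots> = (\<Sum>h<n. A $$ (i, h) * (A ^\<^sub>m Suc k) $$ (h, j))"
    using Suc.prems by (intro sum.cong refl) (simp add: pow_mat_Suc_entry[OF assms(1)] del: pow_mat.simps)
  finally show ?case .
qed

section \<open>Bounds for the spectral radius from test vectors\<close>

lemma rho_nonneg:
  assumes "A \<in> carrier_mat n n" "0 < n"
  shows "0 \<le> rho A"
proof -
  have "map_mat of_nat A \<in> carrier_mat n n" using assms(1) by simp
  from spectral_radius_mem_max(1)[OF this assms(2)] show ?thesis
    unfolding rho_def by auto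
qed

text \<open>The entrywise modulus of an eigenvector of maximal eigenvalue.\<close>

lemma rho_subinvariant_vector:
  assumes A: "A \<in> carrier_mat n n" and n: "0 < n"
  obtains y where "\<And>i. (0::real) \<le> y i" "\<exists>i<n. 0 < y i"
    "\<And>i. i < n \<Longrightarrow> rho A * y i \<le> (\<Sum>j<n. real (A $$ (i, j)) * y j)"
proof -
  let ?B = "map_mat of_nat A :: complex mat"
  have B: "?B \<in> carrier_mat n n" using A by simp
  from spectral_radius_mem_max(1)[OF this n] obtain l where
    l: "eigenvalue ?B l" "norm l = rho A"
    unfolding rho_def spectrum_def by auto
  then obtain x where x: "x \<in> carrier_vec n" "x \<noteq> 0\<^sub>v n" "?B *\<^sub>v x = l \<cdot>\<^sub>v x"
    unfolding eigenvalue_def eigenvector_def using B by auto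
  from x obtain i where i: "i < n" "x $ i \<noteq> 0"
    by (metis carrier_vecD eq_vecI index_zero_vec(1) index_zero_vec(2))
  show ?thesis
  proof
    show "0 \<le> norm (x $ i)" for i by simp
    show "\<exists>i<n. 0 < norm (x $ i)" using i by auto
    fix i assume i: "i < n"
    have "l * x $ i = (\<Sum>j<n. ?B $$ (i, j) * x $ j)"
      using mult_mat_vec_entry[OF B x(1) i] x i by simp
    then have "norm l * norm (x $ i) = norm (\<Sum>j<n. ?B $$ (i, j) * x $ j)"
      by (metis norm_mult)
    also have "\<dots> \<le> (\<Sum>j<n. norm (?B $$ (i, j) * x $ j))" by (rule norm_sum)
    also have "\<dots> = (\<Sum>j<n. real (A $$ (i, j)) * norm (x $ j))"
      using A i by (intro sum.cong) (auto simp: norm_mult)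
    finally show "rho A * norm (x $ i) \<le> (\<Sum>j<n. real (A $$ (i, j)) * norm (x $ j))"
      using l by simp
  qed
qed

text \<open>Half of the Collatz-Wielandt bounds: the subinvariant vector \<open>y\<close> lies below
  a smallest multiple \<open>c * z\<close> and touches it at some index, where the two inequalities
  are compared.\<close>

lemma rho_le_if_superinvariant:
  assumes A: "A \<in> carrier_mat n n" and n: "0 < n"
    and z: "\<And>i. i < n \<Longrightarrow> 0 < z i"
    and le: "\<And>i. i < n \<Longrightarrow> (\<Sum>j<n. real (A $$ (i, j)) * z j) \<le> \<mu> * z i"
  shows "rho A \<le> \<mu>"
proof -
  obtain y where y: "\<And>i. (0::real) \<le> y i" "\<exists>i<n. 0 < y i"
    "\<And>i. i < n \<Longrightarrow> rho A * y i \<le> (\<Sum>j<n. real (A $$ (i, j)) * y j)"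
    using rho_subinvariant_vector[OF A n] by blast
  define c where "c = Max ((\<lambda>i. y i / z i) ` {..<n})"
  have "c \<in> (\<lambda>i. y i / z i) ` {..<n}" unfolding c_def using n by (intro Max_in) auto
  then obtain i where i: "i < n" "c = y i / z i" by auto
  have c: "y j \<le> c * z j" if "j < n" for j
  proof -
    have "y j / z j \<le> c" unfolding c_def using that by (intro Max_ge) auto
    then show ?thesis using z[OF that] by (simp add: field_simps)
  qed
  from y(2) obtain j where j: "j < n" "0 < y j" by auto
  with c[of j] have "0 < c * z j" by simp
  with z[OF j(1)] have c0: "0 < c" by (simp add: zero_less_mult_iff)
  have "rho A * (c * z i) = rho A * y i" using i z[OF i(1)] by simp
  also have "\<dots> \<le> (\<Sum>j<n. real (A $$ (i, j)) * y j)" using y(3)[OF i(1)] .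
  also have "\<dots> \<le> (\<Sum>j<n. real (A $$ (i, j)) * (c * z j))"
    using c by (intro sum_mono mult_left_mono) auto
  also have "\<dots> = c * (\<Sum>j<n. real (A $$ (i, j)) * z j)"
    by (simp add: sum_distrib_left mult_ac)
  also have "\<dots> \<le> c * (\<mu> * z i)" using le[OF i(1)] c0 by (intro mult_left_mono) auto
  finally show ?thesis using c0 z[OF i(1)] by (simp add: mult.left_commute)
qed

text \<open>If \<open>\<rho>(A) < s < \<mu>\<close>, then the powers of \<open>A / s\<close> are bounded, although they expand \<open>z\<close> by the
  factors \<open>(\<mu> / s) ^ k\<close>.\<close>

lemma rho_ge_if_subinvariant:
  assumes A: "A \<in> carrier_mat n n" and n: "0 < n"
    and z: "\<And>i. i < n \<Longrightarrow> 0 < z i"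
    and ge: "\<And>i. i < n \<Longrightarrow> \<mu> * z i \<le> (\<Sum>j<n. real (A $$ (i, j)) * z j)"
  shows "\<mu> \<le> rho A"
proof (rule ccontr)
  assume "\<not> \<mu> \<le> rho A"
  then have "rho A < \<mu>" by simp
  then obtain s where s: "rho A < s" "s < \<mu>" using dense by blast
  have s0: "0 < s" using rho_nonneg[OF A n] s by simp
  let ?A = "map_mat of_nat A :: complex mat"
  have cA: "?A \<in> carrier_mat n n" using A by simp
  \<comment> \<open>\<open>R\<close> is \<open>A / s\<close> over the reals, suited to sign
    arguments; \<open>C\<close> is its complex copy, to which spectral theory applies.\<close>
  define R where "R = map_mat (\<lambda>a. real a / s) A"
  have R: "R \<in> carrier_mat n n" unfolding R_def using A by simp
  define C where "C = (map_mat of_real R :: complex mat)"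
  have C: "C \<in> carrier_mat n n" unfolding C_def using R by simp
  have AC: "?A = complex_of_real s \<cdot>\<^sub>m C"
    using A s0 unfolding C_def R_def by (intro eq_matI) auto
  \<comment> \<open>An eigenvalue of \<open>C\<close> times \<open>s\<close> is an eigenvalue of
    \<open>A\<close>, so its modulus is at most \<open>rho A\<close>, which is below
    \<open>s\<close>.\<close>
  have "spectral_radius C < 1"
  proof -
    from spectral_radius_mem_max(1)[OF C n] obtain l where
      l: "eigenvalue C l" "norm l = spectral_radius C"
      unfolding spectrum_def by auto
    then obtain x where x: "x \<in> carrier_vec n" "x \<noteq> 0\<^sub>v n" "C *\<^sub>v x = l \<cdot>\<^sub>v x"
      unfolding eigenvalue_def eigenvector_def using C by auto
    have "(?A *\<^sub>v x) $ i = of_real s * (C *\<^sub>v x) $ i" if "i < n" for i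
      unfolding mult_mat_vec_entry[OF cA x(1) that] mult_mat_vec_entry[OF C x(1) that]
      using that C unfolding AC by (simp add: sum_distrib_left mult.assoc)
    then have "?A *\<^sub>v x = (of_real s * l) \<cdot>\<^sub>v x"
      using x cA C by (intro eq_vecI) (auto simp del: index_mult_mat_vec)
    then have "eigenvalue ?A (of_real s * l)"
      unfolding eigenvalue_def eigenvector_def using x cA by auto
    then have "norm (of_real s * l) \<le> rho A"
      unfolding rho_def using spectral_radius_mem_max(2)[OF cA n] unfolding spectrum_def by auto
    then have "s * spectral_radius C \<le> rho A" using l(2) s0 by (simp add: norm_mult)
    then have "s * spectral_radius C < s * 1" using s(1) by linarith
    then show ?thesis using s0 by (metis mult_less_cancel_left_pos)
  qed
  \<comment> \<open>One constant bounds the entries of all powers, by the Jordan normal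
    form.\<close>
  from spectral_radius_jnf_norm_bound_less_1_upper_triangular[OF C this] obtain c where
    c: "\<And>k. norm_bound (C ^\<^sub>m k) c" by auto
  have Ck: "C ^\<^sub>m k = map_mat of_real (R ^\<^sub>m k)" for k
    unfolding C_def by (rule of_real_hom.mat_hom_pow[OF R, symmetric])
  have Rk_carrier: "R ^\<^sub>m k \<in> carrier_mat n n" for k using R by simp
  have Rk_le: "(R ^\<^sub>m k) $$ (i, j) \<le> c" if "i < n" "j < n" for i j k
  proof -
    have "norm ((C ^\<^sub>m k) $$ (i, j)) \<le> c"
      using c[of k] that pow_carrier_mat[OF C, of k] unfolding norm_bound_def
      by (metis carrier_matD)
    moreover have "(C ^\<^sub>m k) $$ (i, j) = of_real ((R ^\<^sub>m k) $$ (i, j))"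
      using that Rk_carrier[of k] unfolding Ck by (metis carrier_matD index_map_mat(1))
    ultimately show ?thesis by simp
  qed
  have R_entry: "R $$ (i, j) = real (A $$ (i, j)) / s" if "i < n" "j < n" for i j
    using that A unfolding R_def by auto
  have Rk_nonneg: "0 \<le> (R ^\<^sub>m k) $$ (i, j)" if "i < n" "j < n" for i j k
    using that
  proof (induction k arbitrary: i j)
    case (Suc k)
    then show ?case
      using s0 by (auto simp: pow_mat_Suc_entry[OF R] R_entry simp del: pow_mat.simps
          intro!: sum_nonneg)
  qed (use R in auto)
  have grow: "(\<mu> / s) ^ k * z i \<le> (\<Sum>j<n. (R ^\<^sub>m k) $$ (i, j) * z j)" if "i < n" for i k
    using that
  proof (induction k arbitrary: i)
    case 0
    then show ?case using R by (simp add: if_distrib[where f="\<lambda>x. x * _"] cong: if_cong)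
  next
    case (Suc k)
    have "(\<mu> / s) ^ Suc k * z i = (\<mu> / s) * ((\<mu> / s) ^ k * z i)" by simp
    also have "\<dots> \<le> (\<mu> / s) * (\<Sum>l<n. (R ^\<^sub>m k) $$ (i, l) * z l)"
      using Suc s s0 by (intro mult_left_mono) auto
    also have "\<dots> = (\<Sum>l<n. (R ^\<^sub>m k) $$ (i, l) * ((\<mu> * z l) / s))"
      by (simp add: sum_distrib_left mult_ac)
    also have "\<dots> \<le> (\<Sum>l<n. (R ^\<^sub>m k) $$ (i, l) * ((\<Sum>j<n. real (A $$ (l, j)) * z j) / s))"
      using s0 Rk_nonneg Suc.prems ge by (intro sum_mono mult_left_mono divide_right_mono) auto
    also have "\<dots> = (\<Sum>l<n. (R ^\<^sub>m k) $$ (i, l) * (\<Sum>j<n. R $$ (l, j) * z j))"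
      by (intro sum.cong refl arg_cong2[where f="(*)"]) (auto simp: R_entry sum_divide_distrib)
    also have "\<dots> = (\<Sum>j<n. (R ^\<^sub>m Suc k) $$ (i, j) * z j)"
      using Suc.prems
      by (simp add: pow_mat_Suc_entry[OF R] sum_distrib_left sum_distrib_right mult_ac
          del: pow_mat.simps) (rule sum.swap)
    finally show ?case .
  qed
  have "(\<mu> / s) ^ k * z 0 \<le> c * (\<Sum>j<n. z j)" for k
  proof -
    have "(\<mu> / s) ^ k * z 0 \<le> (\<Sum>j<n. (R ^\<^sub>m k) $$ (0, j) * z j)" using grow n by blast
    also have "\<dots> \<le> (\<Sum>j<n. c * z j)"
      using Rk_le n z by (intro sum_mono mult_right_mono) (auto intro: less_imp_le)
    finally show ?thesis by (simp add: sum_distrib_left)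
  qed
  \<comment> \<open>At coordinate 0 the left side grows geometrically, while the right side is
    independent of \<open>k\<close>.\<close>
  moreover have "1 < \<mu> / s" using s s0 by simp
  from real_arch_pow[OF this] obtain k where "c * (\<Sum>j<n. z j) / z 0 < (\<mu> / s) ^ k" by blast
  ultimately show False using z[OF n] by (smt (verit) pos_divide_less_eq)
qed

text \<open>Were the subinvariant vector \<open>y\<close> not invariant, then a positive power of \<open>A\<close> would
  turn it into a strictly subinvariant one.\<close>

theorem primitive_perron_vector:
  assumes A: "A \<in> carrier_mat n n" and n: "0 < n" and prim: "primitive_mat A"
  obtains y where "\<And>i. i < n \<Longrightarrow> (0::real) < y i"
    "\<And>i. i < n \<Longrightarrow> (\<Sum>j<n. real (A $$ (i, j)) * y j) = rho A * y i"
proof -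
  obtain y where y: "\<And>i. (0::real) \<le> y i" "\<exists>i<n. 0 < y i"
    "\<And>i. i < n \<Longrightarrow> rho A * y i \<le> (\<Sum>j<n. real (A $$ (i, j)) * y j)"
    using rho_subinvariant_vector[OF A n] by blast
  from prim obtain k where "positive_mat (A ^\<^sub>m k)" unfolding primitive_mat_def by auto
  then have pos: "0 < (A ^\<^sub>m k) $$ (i, j)" if "i < n" "j < n" for i j
    using that pow_carrier_mat[OF A, of k] unfolding positive_mat_def
    by (metis carrier_matD)
  \<comment> \<open>\<open>P\<close> applies the positive power \<open>A ^\<^sub>m k\<close> to a
    vector.\<close>
  define P where "P x i = (\<Sum>j<n. real ((A ^\<^sub>m k) $$ (i, j)) * x j)" for x and i
  have P_pos: "0 < P x i" if "i < n" "\<And>j. j < n \<Longrightarrow> 0 \<le> x j" "\<exists>j<n. 0 < x j" for x i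
  proof -
    from that obtain j where j: "j < n" "0 < x j" by auto
    have "0 < real ((A ^\<^sub>m k) $$ (i, j)) * x j" using pos[OF that(1) j(1)] j by simp
    also have "\<dots> \<le> P x i"
      unfolding P_def using that j by (intro member_le_sum) auto
    finally show ?thesis .
  qed
  define Ay where "Ay i = (\<Sum>j<n. real (A $$ (i, j)) * y j)" for i
  have comm: "(\<Sum>j<n. real (A $$ (i, j)) * P y j) = P Ay i" if "i < n" for i
  proof -
    have "(\<Sum>l<n. A $$ (i, l) * (A ^\<^sub>m k) $$ (l, j)) = (\<Sum>l<n. (A ^\<^sub>m k) $$ (i, l) * A $$ (l, j))"
      if "j < n" for j
      using pow_mat_Suc_entry[OF A \<open>i < n\<close> that, of k] pow_mat_Suc_entry'[OF A \<open>i < n\<close> that, of k]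
      by simp
    then have *: "(\<Sum>l<n. real (A $$ (i, l)) * real ((A ^\<^sub>m k) $$ (l, j)))
      = (\<Sum>l<n. real ((A ^\<^sub>m k) $$ (i, l)) * real (A $$ (l, j)))" if "j < n" for j
      using that by (simp flip: of_nat_mult of_nat_sum)
    have "(\<Sum>l<n. real (A $$ (i, l)) * P y l)
      = (\<Sum>j<n. (\<Sum>l<n. real (A $$ (i, l)) * real ((A ^\<^sub>m k) $$ (l, j))) * y j)"
      unfolding P_def sum_distrib_left sum_distrib_right by (subst sum.swap) (simp add: mult_ac)
    also have "\<dots> = (\<Sum>j<n. (\<Sum>l<n. real ((A ^\<^sub>m k) $$ (i, l)) * real (A $$ (l, j))) * y j)"
      using * by (intro sum.cong) auto
    also have "\<dots> = P Ay i"
      unfolding P_def Ay_def sum_distrib_left sum_distrib_right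
      by (subst sum.swap) (simp add: mult_ac)
    finally show ?thesis .
  qed
  have inv: "Ay i = rho A * y i" if i: "i < n" for i
  proof (rule ccontr)
    assume "Ay i \<noteq> rho A * y i"
    \<comment> \<open>The defect \<open>d\<close> is nonnegative and not zero, so \<open>P d\<close>
      is positive in every coordinate.\<close>
    define d where "d j = Ay j - rho A * y j" for j
    have d: "0 \<le> d j" if "j < n" for j using y(3)[OF that] by (simp add: d_def Ay_def)
    have "0 < d i" using d[OF i] \<open>Ay i \<noteq> _\<close> by (simp add: d_def)
    with i d have Pd: "0 < P d j" if "j < n" for j using P_pos[OF that, of d] by auto
    have Py: "0 < P y j" if "j < n" for j using P_pos[OF that, of y] y by auto
    \<comment> \<open>The largest \<epsilon> with \<open>\<epsilon> * P y j \<le> P d j\<close> for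
      all \<open>j\<close>. Since \<open>A\<close> commutes with its power, applying
      \<open>A\<close> to \<open>P y\<close> yields \<open>rho A * P y + P d\<close>.\<close>
    define \<epsilon> where "\<epsilon> = Min ((\<lambda>j. P d j / P y j) ` {..<n})"
    have "0 < \<epsilon>" unfolding \<epsilon>_def using n Pd Py by (subst Min_gr_iff) auto
    have "(rho A + \<epsilon>) * P y j \<le> (\<Sum>l<n. real (A $$ (j, l)) * P y l)" if "j < n" for j
    proof -
      have "\<epsilon> \<le> P d j / P y j" unfolding \<epsilon>_def using that by (intro Min_le) auto
      then have "\<epsilon> * P y j \<le> P d j" using Py[OF that] by (simp add: field_simps)
      also have "P d j = P Ay j - rho A * P y j"
        unfolding P_def d_def
        by (simp add: sum_subtractf sum_distrib_left algebra_simps)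
      finally show ?thesis using comm[OF that] by (simp add: algebra_simps)
    qed
    from rho_ge_if_subinvariant[OF A n Py this] \<open>0 < \<epsilon>\<close> show False by simp
  qed
  \<comment> \<open>At the exponent \<open>k\<close> the left side is \<open>P y\<close>, which is
    positive; hence no entry of \<open>y\<close> vanishes.\<close>
  have pow: "(\<Sum>j<n. real ((A ^\<^sub>m m) $$ (i, j)) * y j) = rho A ^ m * y i" if "i < n" for i m
    using that
  proof (induction m arbitrary: i)
    case 0
    then show ?case
      using A by (simp add: if_distrib[where f="\<lambda>x. real x * _"] cong: if_cong)
  next
    case (Suc m)
    have "(\<Sum>j<n. real ((A ^\<^sub>m Suc m) $$ (i, j)) * y j)
      = (\<Sum>l<n. real ((A ^\<^sub>m m) $$ (i, l)) * Ay l)"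
      using Suc.prems
      by (simp add: pow_mat_Suc_entry[OF A] Ay_def sum_distrib_left sum_distrib_right mult_ac
          del: pow_mat.simps) (rule sum.swap)
    also have "\<dots> = (\<Sum>l<n. rho A * (real ((A ^\<^sub>m m) $$ (i, l)) * y l))"
      using inv by (intro sum.cong) auto
    also have "\<dots> = rho A ^ Suc m * y i"
      using Suc by (simp flip: sum_distrib_left)
    finally show ?case .
  qed
  show ?thesis
  proof
    show "(\<Sum>j<n. real (A $$ (i, j)) * y j) = rho A * y i" if "i < n" for i
      using inv[OF that] by (simp add: Ay_def)
    show "0 < y i" if "i < n" for i
      using P_pos[OF that, of y] y pow[OF that, of k] unfolding P_def
      by (metis mult_eq_0_iff not_less_iff_gr_or_eq less_eq_real_def)
  qed
qed

lemma positive_mat_primitive: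
  assumes "A \<in> carrier_mat n n" "positive_mat A"
  shows "primitive_mat A"
  using assms unfolding primitive_mat_def
  by (intro conjI exI[of _ 1]) (auto simp: left_mult_one_mat)

text \<open>A positive matrix turns the slack in one coordinate into slack in all of them.\<close>

lemma rho_less_if_strictly_superinvariant:
  assumes A: "A \<in> carrier_mat n n" and n: "0 < n" and pos: "positive_mat A"
    and z: "\<And>i. i < n \<Longrightarrow> 0 < z i"
    and le: "\<And>i. i < n \<Longrightarrow> (\<Sum>j<n. real (A $$ (i, j)) * z j) \<le> \<mu> * z i"
    and less: "h < n" "(\<Sum>j<n. real (A $$ (h, j)) * z j) < \<mu> * z h"
  shows "rho A < \<mu>"
proof -
  have Apos: "0 < A $$ (i, j)" if "i < n" "j < n" for i j
    using that A pos unfolding positive_mat_def by auto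
  \<comment> \<open>The image of \<open>z\<close> under \<open>A\<close> is the better test vector:
    each of its rows sees the slack at \<open>h\<close> with a positive coefficient.\<close>
  define x where "x i = (\<Sum>j<n. real (A $$ (i, j)) * z j)" for i
  have x: "0 < x i" if "i < n" for i
    unfolding x_def using Apos z that n by (intro sum_pos) auto
  have Ax: "(\<Sum>j<n. real (A $$ (i, j)) * x j) < \<mu> * x i" if i: "i < n" for i
  proof -
    have "(\<Sum>j<n. real (A $$ (i, j)) * x j) < (\<Sum>j<n. real (A $$ (i, j)) * (\<mu> * z j))"
    proof (rule sum_strict_mono_ex1)
      show "\<forall>j\<in>{..<n}. real (A $$ (i, j)) * x j \<le> real (A $$ (i, j)) * (\<mu> * z j)"
        using le unfolding x_def by (auto intro!: mult_left_mono)
      show "\<exists>j\<in>{..<n}. real (A $$ (i, j)) * x j < real (A $$ (i, j)) * (\<mu> * z j)"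
        using less Apos[OF i less(1)] unfolding x_def by (intro bexI[of _ h]) auto
    qed simp
    also have "\<dots> = \<mu> * x i" unfolding x_def by (simp add: sum_distrib_left mult_ac)
    finally show ?thesis .
  qed
  \<comment> \<open>A maximum over finitely many rows, so the strict inequalities leave a uniform
    gap below \<mu>.\<close>
  define \<nu> where "\<nu> = Max ((\<lambda>i. (\<Sum>j<n. real (A $$ (i, j)) * x j) / x i) ` {..<n})"
  have "\<nu> < \<mu>" unfolding \<nu>_def using n Ax x by (subst Max_less_iff) (auto simp: field_simps)
  moreover have "(\<Sum>j<n. real (A $$ (i, j)) * x j) \<le> \<nu> * x i" if "i < n" for i
  proof -
    have "(\<Sum>j<n. real (A $$ (i, j)) * x j) / x i \<le> \<nu>"
      unfolding \<nu>_def using that by (intro Max_ge) auto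
    then show ?thesis using x[OF that] by (simp add: field_simps)
  qed
  from rho_le_if_superinvariant[OF A n x this] have "rho A \<le> \<nu>" .
  ultimately show ?thesis by simp
qed

section \<open>Weighted distances in underlying graphs\<close>

lemma undirected_simps [simp]:
  "verts (undirected G) = verts G"
  "arcs (undirected G) = arcs G \<times> UNIV"
  "tail (undirected G) (e, d) = (if d then tail G e else head G e)"
  "head (undirected G) (e, d) = (if d then head G e else tail G e)"
  by (auto simp: undirected_def)

lemma wf_undirected: "wf_digraph G \<Longrightarrow> wf_digraph (undirected G)"
  by (auto simp: wf_digraph_def)

lemma fin_undirected: "fin_digraph G \<Longrightarrow> fin_digraph (undirected G)"
  using wf_undirected[of G]
  by (auto simp: fin_digraph_def fin_digraph_axioms_def)

text \<open>Connectedness refers to \<open>mk_symmetric G\<close>. Reachability depends only on the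
  pairs of end points of arcs, and these agree with those of \<open>undirected G\<close>.\<close>

lemma ex_undirected_walk:
  assumes G: "wf_digraph G" and conn: "Digraph_Component.connected G"
    and "a \<in> verts G" "b \<in> verts G"
  shows "\<exists>p. pre_digraph.awalk (undirected G) a p b"
proof -
  interpret U: wf_digraph "undirected G" by (rule wf_undirected[OF G])
  have "arcs_ends (mk_symmetric G) = arcs_ends (undirected G)"
  proof -
    have "arcs_ends (undirected G)
      = (\<Union>e\<in>arcs G. {(tail G e, head G e), (head G e, tail G e)})"
    proof (intro equalityI subsetI)
      fix z assume "z \<in> arcs_ends (undirected G)"
      then show "z \<in> (\<Union>e\<in>arcs G. {(tail G e, head G e), (head G e, tail G e)})"
        by (auto simp: arcs_ends_conv split: if_splits)
    next
      fix z assume "z \<in> (\<Union>e\<in>arcs G. {(tail G e, head G e), (head G e, tail G e)})"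
      then obtain e where e: "e \<in> arcs G"
        "z = (tail G e, head G e) \<or> z = (head G e, tail G e)" by auto
      \<comment> \<open>The truth value of the equation serves as the direction flag, so both
        orientations are treated at once.\<close>
      then have "(e, z = (tail G e, head G e)) \<in> arcs (undirected G)" by simp
      then have "(tail (undirected G) (e, z = (tail G e, head G e)),
          head (undirected G) (e, z = (tail G e, head G e))) \<in> arcs_ends (undirected G)"
        unfolding arcs_ends_conv by (rule imageI)
      then show "z \<in> arcs_ends (undirected G)" using e by (auto split: if_splits)
    qed
    then show ?thesis by (simp add: parcs_mk_symmetric)
  qed
  moreover have "a \<rightarrow>\<^sup>*\<^bsub>mk_symmetric G\<^esub> b"
    using conn assms(3,4) by (auto simp: connected_def strongly_connected_def)
  ultimately have "a \<rightarrow>\<^sup>*\<^bsub>undirected G\<^esub> b" by (simp add: reachable_def)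
  then show ?thesis by (simp add: U.reachable_awalk)
qed

section \<open>Costs of walks and Lipschitz potentials\<close>

abbreviation walk_cost :: "('b \<Rightarrow> real) \<Rightarrow> ('b \<times> bool) list \<Rightarrow> real" where
  "walk_cost \<omega> p \<equiv> (\<Sum>(e, _)\<leftarrow>p. \<omega> e)"

lemma walk_cost_nonneg:
  assumes "pre_digraph.awalk (undirected G) a p b" "\<And>e. e \<in> arcs G \<Longrightarrow> 0 \<le> \<omega> e"
  shows "0 \<le> walk_cost \<omega> p"
  using assms by (intro sum_list_nonneg) (auto simp: pre_digraph.awalk_def)

text \<open>Such functions certify lower bounds: their difference at two vertices never exceeds the
  cost of a walk between them.\<close>

definition lipschitz_arcs :: "('a, 'b) pre_digraph \<Rightarrow> ('b \<Rightarrow> real) \<Rightarrow> ('a \<Rightarrow> real) \<Rightarrow> bool" where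
  "lipschitz_arcs G \<omega> f \<longleftrightarrow> (\<forall>e \<in> arcs G. \<bar>f (tail G e) - f (head G e)\<bar> \<le> \<omega> e)"

lemma lipschitz_arcsD:
  assumes "lipschitz_arcs G \<omega> f" "e \<in> arcs G"
  shows "f (tail G e) \<le> f (head G e) + \<omega> e" "f (head G e) \<le> f (tail G e) + \<omega> e"
  using assms unfolding lipschitz_arcs_def by (auto simp: abs_le_iff dest!: bspec)

lemma lipschitz_walk:
  assumes G: "wf_digraph G" and lip: "lipschitz_arcs G \<omega> f"
    and walk: "pre_digraph.awalk (undirected G) a p b"
  shows "f b \<le> f a + walk_cost \<omega> p"
proof -
  interpret U: wf_digraph "undirected G" by (rule wf_undirected[OF G])
  show ?thesis using walk
  proof (induction p arbitrary: a)
    case Nil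
    then show ?case by (simp add: U.awalk_Nil_iff)
  next
    case (Cons x p)
    obtain e d where x: "x = (e, d)" by (cases x)
    from Cons.prems have e: "e \<in> arcs G" "a = tail (undirected G) (e, d)"
      "U.awalk (head (undirected G) (e, d)) p b"
      by (auto simp: U.awalk_Cons_iff x)
    from Cons.IH[OF e(3)] lipschitz_arcsD[OF lip e(1)] show ?case
      by (auto simp: x e(2) split: if_splits)
  qed
qed

text \<open>An arc counts 1 in \<open>graph_dist\<close> and at most \<open>M\<close> in \<omega>,
  so a weighted lower bound becomes an unweighted one after division by \<open>M\<close>.\<close>

lemma graph_dist_ge:
  assumes G: "wf_digraph G" and lip: "lipschitz_arcs G \<omega> f"
    and le: "\<And>e. e \<in> arcs G \<Longrightarrow> \<omega> e \<le> M" and M: "0 < M"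
  shows "ereal ((f b - f a) / M) \<le> graph_dist G a b"
proof -
  interpret U: wf_digraph "undirected G" by (rule wf_undirected[OF G])
  show ?thesis unfolding graph_dist_def U.\<mu>_def
  proof (rule INF_greatest)
    fix p assume "p \<in> {p. U.awalk a p b}"
    then have walk: "U.awalk a p b" by simp
    have "f b - f a \<le> walk_cost \<omega> p" using lipschitz_walk[OF G lip walk] by simp
    also have "\<dots> \<le> (\<Sum>_\<leftarrow>p. M)"
      using walk le by (intro sum_list_mono) (auto simp: U.awalk_def)
    also have "\<dots> = M * U.awalk_cost (\<lambda>_. 1) p"
      by (simp add: U.awalk_cost_def sum_list_triv)
    finally show "ereal ((f b - f a) / M) \<le> ereal (U.awalk_cost (\<lambda>_. 1) p)"
      using M by (simp add: field_simps)
  qed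
qed

text \<open>An upper bound for the weighted distance, stated through a witnessing walk so that no
  infimum has to be handled when walks are joined or substituted.\<close>

definition within_cost ::
  "('a, 'b) pre_digraph \<Rightarrow> ('b \<Rightarrow> real) \<Rightarrow> 'a \<Rightarrow> 'a \<Rightarrow> real \<Rightarrow> bool" where
  "within_cost G \<omega> a b c \<longleftrightarrow>
     (\<exists>p. pre_digraph.awalk (undirected G) a p b \<and> walk_cost \<omega> p \<le> c)"

lemma within_cost_refl: "a \<in> verts G \<Longrightarrow> within_cost G \<omega> a a 0"
  unfolding within_cost_def by (intro exI[of _ "[]"]) (simp add: pre_digraph.awalk_def pre_digraph.cas.simps)

lemma within_cost_mono: "within_cost G \<omega> a b c \<Longrightarrow> c \<le> d \<Longrightarrow> within_cost G \<omega> a b d"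
  unfolding within_cost_def by force

lemma within_cost_trans:
  assumes "wf_digraph G" "within_cost G \<omega> a b c" "within_cost G \<omega> b d c'"
  shows "within_cost G \<omega> a d (c + c')"
proof -
  interpret U: wf_digraph "undirected G" by (rule wf_undirected[OF assms(1)])
  from assms(2,3) obtain p q where "U.awalk a p b" "walk_cost \<omega> p \<le> c"
    "U.awalk b q d" "walk_cost \<omega> q \<le> c'"
    unfolding within_cost_def by auto
  then show ?thesis unfolding within_cost_def
    by (intro exI[of _ "p @ q"] conjI U.awalk_appendI) (auto simp del: U.awalk_append_iff)
qed

lemma within_cost_arc:
  assumes G: "wf_digraph G" and e: "e \<in> arcs G"
  shows "within_cost G \<omega> (tail G e) (head G e) (\<omega> e)"
    "within_cost G \<omega> (head G e) (tail G e) (\<omega> e)"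
proof -
  interpret U: wf_digraph "undirected G" by (rule wf_undirected[OF G])
  have "tail G e \<in> verts G" "head G e \<in> verts G" using G e by (auto simp: wf_digraph_def)
  then have 1: "U.awalk (tail G e) [(e, True)] (head G e)" and 2: "U.awalk (head G e) [(e, False)] (tail G e)"
    using e by (auto simp: U.awalk_simps)
  show "within_cost G \<omega> (tail G e) (head G e) (\<omega> e)"
    "within_cost G \<omega> (head G e) (tail G e) (\<omega> e)"
    unfolding within_cost_def
    by (intro exI[of _ "[(e, True)]"] conjI 1, simp) (intro exI[of _ "[(e, False)]"] conjI 2, simp)
qed

text \<open>Each arc of a walk in \<open>G\<close> is replaced by a walk in \<open>H\<close>. Needed
  for copies of rule graphs, with \<phi> the planting map, and for the passage to the next level,
  with \<phi> the identity.\<close>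

lemma within_cost_by_steps:
  assumes G: "wf_digraph G" and H: "wf_digraph H"
    and walk: "pre_digraph.awalk (undirected G) a p b"
    and verts: "\<And>x. x \<in> verts G \<Longrightarrow> \<phi> x \<in> verts H"
    and step: "\<And>e. e \<in> arcs G \<Longrightarrow> within_cost H \<omega> (\<phi> (tail G e)) (\<phi> (head G e)) (\<omega>' e)
      \<and> within_cost H \<omega> (\<phi> (head G e)) (\<phi> (tail G e)) (\<omega>' e)"
  shows "within_cost H \<omega> (\<phi> a) (\<phi> b) (walk_cost \<omega>' p)"
proof -
  interpret U: wf_digraph "undirected G" by (rule wf_undirected[OF G])
  show ?thesis using walk
  proof (induction p arbitrary: a)
    case Nil
    then show ?case using verts by (auto simp: U.awalk_Nil_iff intro: within_cost_refl)
  next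
    case (Cons x p)
    obtain e d where x: "x = (e, d)" by (cases x)
    from Cons.prems have e: "e \<in> arcs G" "a = tail (undirected G) (e, d)"
      "U.awalk (head (undirected G) (e, d)) p b"
      by (auto simp: U.awalk_Cons_iff x)
    have "within_cost H \<omega> (\<phi> a) (\<phi> (head (undirected G) (e, d))) (\<omega>' e)"
      using step[OF e(1)] e(2) by auto
    from within_cost_trans[OF H this Cons.IH[OF e(3)]] show ?case by (simp add: x)
  qed
qed

lemma within_cost_sym:
  assumes G: "wf_digraph G" and "within_cost G \<omega> a b c"
  shows "within_cost G \<omega> b a c"
proof -
  interpret U: wf_digraph "undirected G" by (rule wf_undirected[OF G])
  from assms obtain p where p: "U.awalk a p b" "walk_cost \<omega> p \<le> c"
    unfolding within_cost_def by auto
  have "within_cost G \<omega> b a (walk_cost \<omega> p)" using p(1)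
  proof (induction p arbitrary: a)
    case Nil
    then show ?case by (auto simp: U.awalk_Nil_iff intro: within_cost_refl)
  next
    case (Cons x p)
    obtain e d where x: "x = (e, d)" by (cases x)
    from Cons.prems have e: "e \<in> arcs G" "a = tail (undirected G) (e, d)"
      "U.awalk (head (undirected G) (e, d)) p b"
      by (auto simp: U.awalk_Cons_iff x)
    have "within_cost G \<omega> (head (undirected G) (e, d)) a (\<omega> e)"
      using within_cost_arc[OF G e(1)] e(2) by auto
    from within_cost_trans[OF G Cons.IH[OF e(3)] this] show ?case by (simp add: x add.commute)
  qed
  then show ?thesis using p(2) by (rule within_cost_mono)
qed

lemma graph_dist_le:
  assumes G: "wf_digraph G" and "within_cost G \<omega> a b c"
    and ge: "\<And>e. e \<in> arcs G \<Longrightarrow> m \<le> \<omega> e" and m: "0 < m"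
  shows "graph_dist G a b \<le> ereal (c / m)"
proof -
  interpret U: wf_digraph "undirected G" by (rule wf_undirected[OF G])
  from assms obtain p where p: "U.awalk a p b" "walk_cost \<omega> p \<le> c"
    unfolding within_cost_def by auto
  have "m * U.awalk_cost (\<lambda>_. 1) p = (\<Sum>_\<leftarrow>p. m)"
    by (simp add: U.awalk_cost_def sum_list_triv)
  also have "\<dots> \<le> walk_cost \<omega> p"
    using p ge by (intro sum_list_mono) (auto simp: U.awalk_def)
  finally have "U.awalk_cost (\<lambda>_. 1) p \<le> c / m" using p(2) m by (simp add: field_simps)
  moreover have "graph_dist G a b \<le> U.awalk_cost (\<lambda>_. 1) p"
    unfolding graph_dist_def by (rule U.min_cost_le_walk_cost[OF p(1)])
  ultimately show ?thesis by (meson ereal_less_eq(3) order_trans)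
qed

text \<open>Removing cycles does not raise the cost if weights are nonnegative. This links walks to
  the simple paths that define the distance matrices.\<close>

lemma apath_cost_le:
  assumes G: "wf_digraph G" and walk: "pre_digraph.awalk (undirected G) a p b"
    and nonneg: "\<And>e. e \<in> arcs G \<Longrightarrow> 0 \<le> \<omega> e"
  shows "\<exists>q. simple_path G a q b \<and> walk_cost \<omega> q \<le> walk_cost \<omega> p"
proof -
  interpret U: wf_digraph "undirected G" by (rule wf_undirected[OF G])
  let ?f = "\<lambda>(e, _). \<omega> e"
  have "U.awalk_cost ?f (U.awalk_to_apath p) \<le> U.awalk_cost ?f p"
    using walk
  proof (rule U.awalk_to_path_no_neg_cyc_cost)
    show "\<not> (\<exists>w c. U.awalk w c w \<and> w \<in> set (U.awalk_verts a p) \<and> U.awalk_cost ?f c < 0)"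
      using walk_cost_nonneg[OF _ nonneg] unfolding U.awalk_cost_def
      by (auto simp: not_less)
  qed
  with U.apath_awalk_to_apath[OF walk] show ?thesis
    unfolding simple_path_def U.awalk_cost_def by blast
qed

text \<open>The potential is the weighted distance from \<open>a\<close>, cut off at \<open>t\<close>.\<close>

lemma ex_potential:
  assumes G: "wf_digraph G" and conn: "Digraph_Component.connected G"
    and ab: "a \<in> verts G" "b \<in> verts G"
    and nonneg: "\<And>e. e \<in> arcs G \<Longrightarrow> 0 \<le> \<omega> e"
    and t: "0 \<le> t" "\<And>p. simple_path G a p b \<Longrightarrow> t \<le> walk_cost \<omega> p"
  shows "\<exists>f. lipschitz_arcs G \<omega> f \<and> f a = 0 \<and> f b = t \<and> (\<forall>x\<in>verts G. 0 \<le> f x \<and> f x \<le> t)"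
proof -
  interpret U: wf_digraph "undirected G" by (rule wf_undirected[OF G])
  define costs where "costs x = walk_cost \<omega> ` {p. U.awalk a p x}" for x
  have ne: "costs x \<noteq> {}" if "x \<in> verts G" for x
    using ex_undirected_walk[OF G conn ab(1) that] unfolding costs_def by auto
  have ge0: "0 \<le> c" if "c \<in> costs x" for c x
    using that walk_cost_nonneg[OF _ nonneg] unfolding costs_def by auto
  have bdd: "bdd_below (costs x)" for x using ge0 by (rule bdd_belowI)
  define D where "D x = Inf (costs x)" for x
  have D0: "0 \<le> D x" if "x \<in> verts G" for x
    unfolding D_def using ne[OF that] ge0 by (intro cInf_greatest)
  have "0 \<in> costs a" unfolding costs_def using ab by (auto simp: U.awalk_Nil_iff intro!: image_eqI[of _ _ "[]"])
  then have Da: "D a = 0" unfolding D_def using ge0 bdd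
    by (intro antisym cInf_lower cInf_greatest) auto
  have Db: "t \<le> D b" unfolding D_def
  proof (rule cInf_greatest[OF ne[OF ab(2)]])
    fix c assume "c \<in> costs b"
    then obtain p where p: "U.awalk a p b" "c = walk_cost \<omega> p" unfolding costs_def by auto
    from apath_cost_le[OF G p(1), of \<omega>, OF nonneg] obtain q where
      q: "simple_path G a q b" "walk_cost \<omega> q \<le> walk_cost \<omega> p" by blast
    then show "t \<le> c" unfolding p(2) using t(2)[OF q(1)] by linarith
  qed
  have step: "D (head (undirected G) (e, d)) \<le> D (tail (undirected G) (e, d)) + \<omega> e"
    if e: "e \<in> arcs G" for e d
  proof -
    let ?x = "tail (undirected G) (e, d)" and ?y = "head (undirected G) (e, d)"
    have x: "?x \<in> verts G" and y: "?y \<in> verts G" using G e by (auto simp: wf_digraph_def)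
    have "D ?y - \<omega> e \<le> D ?x" unfolding D_def[of ?x]
    proof (rule cInf_greatest[OF ne[OF x]])
      fix c assume "c \<in> costs ?x"
      then obtain p where p: "U.awalk a p ?x" "c = walk_cost \<omega> p" unfolding costs_def by auto
      have "U.awalk ?x [(e, d)] ?y" using e y by (simp add: U.awalk_simps)
      from U.awalk_appendI[OF p(1) this] have "walk_cost \<omega> (p @ [(e, d)]) \<in> costs ?y"
        unfolding costs_def by (intro imageI CollectI)
      then have "c + \<omega> e \<in> costs ?y" by (simp add: p(2))
      then have "D ?y \<le> c + \<omega> e" unfolding D_def by (rule cInf_lower[OF _ bdd])
      then show "D ?y - \<omega> e \<le> c" by simp
    qed
    then show ?thesis by simp
  qed
  \<comment> \<open>The cut-off preserves the Lipschitz bound and, as \<open>t \<le> D b\<close>,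
    makes the value at \<open>b\<close> exactly \<open>t\<close>.\<close>
  have "lipschitz_arcs G \<omega> (\<lambda>x. min t (D x))"
    unfolding lipschitz_arcs_def
  proof
    fix e assume e: "e \<in> arcs G"
    from step[OF e, of True] step[OF e, of False]
    show "\<bar>min t (D (tail G e)) - min t (D (head G e))\<bar> \<le> \<omega> e" by (auto simp: min_def)
  qed
  then show ?thesis using Da Db D0 t(1) by (intro exI[of _ "\<lambda>x. min t (D x)"]) auto
qed

section \<open>Addresses and degrees\<close>

declare Xi.simps [simp del]

locale eigs_system =
  fixes S :: "('v, 'e) eigs"
  assumes valid: "valid_eigs S"
begin

abbreviation K :: nat where "K \<equiv> ncolours S"
abbreviation R :: "nat \<Rightarrow> ('v, 'e) pre_digraph" where "R i \<equiv> dgraph (rule S i)"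
abbreviation col :: "nat \<Rightarrow> 'e \<Rightarrow> nat" where "col i \<equiv> colour (rule S i)"
abbreviation pos :: "nat \<Rightarrow> 'v" where "pos \<equiv> plus_vertex S"
abbreviation neg :: "nat \<Rightarrow> 'v" where "neg \<equiv> minus_vertex S"
abbreviation G :: "nat \<Rightarrow> (('v, 'e) eigs_vertex, 'e list) pre_digraph" where "G \<equiv> Xi_graph S"
abbreviation C :: "nat \<Rightarrow> 'e list \<Rightarrow> nat" where "C n \<equiv> colour (Xi S n)"
abbreviation pl :: "nat \<Rightarrow> 'e list \<Rightarrow> 'v \<Rightarrow> ('v, 'e) eigs_vertex" where
  "pl n \<equiv> plant S (Xi S n)"

section \<open>Recursive structure of the levels\<close>

lemma rule_graph:
  assumes "i < K"
  shows "fin_digraph (R i)" "wf_digraph (R i)" "loopfree_digraph (R i)"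
    "Digraph_Component.connected (R i)" "\<And>e. e \<in> arcs (R i) \<Longrightarrow> col i e < K"
    "pos i \<in> verts (R i)" "neg i \<in> verts (R i)" "pos i \<noteq> neg i"
  using valid assms
  by (auto simp: valid_eigs_def Let_def underlying_simple_def loopfree_digraph_def)

lemma rule_wf: "i < K \<Longrightarrow> e \<in> arcs (R i) \<Longrightarrow> tail (R i) e \<in> verts (R i) \<and> head (R i) e \<in> verts (R i)"
  using rule_graph(2) by (simp add: wf_digraph_def)

lemma init_colour: "init_colour S < K" and K_pos: "0 < K"
  using valid by (auto simp: valid_eigs_def)

lemma Xi_graph_0:
  "verts (G 0) = {Init_Plus, Init_Minus}" "arcs (G 0) = {[]}"
  "tail (G 0) w = Init_Plus" "head (G 0) w = Init_Minus" "C 0 w = init_colour S"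
  by (simp_all add: Xi_graph_def Xi.simps)

lemma Xi_graph_Suc:
  "verts (G (Suc n)) = verts (G n) \<union> (\<Union>w \<in> arcs (G n). pl n w ` verts (R (C n w)))"
  "arcs (G (Suc n)) = {e # w | e w. w \<in> arcs (G n) \<and> e \<in> arcs (R (C n w))}"
  "tail (G (Suc n)) (e # w) = pl n w (tail (R (C n w)) e)"
  "head (G (Suc n)) (e # w) = pl n w (head (R (C n w)) e)"
  "C (Suc n) (e # w) = col (C n w) e"
  by (simp_all add: Xi_graph_def Xi.simps substitute_def Let_def)

lemma arcs_SucE:
  assumes "a \<in> arcs (G (Suc n))"
  obtains e w where "a = e # w" "w \<in> arcs (G n)" "e \<in> arcs (R (C n w))"
  using assms by (auto simp: Xi_graph_Suc)

lemma arc_colour: "w \<in> arcs (G n) \<Longrightarrow> C n w < K"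
proof (induction n arbitrary: w)
  case 0
  then show ?case using init_colour by (simp add: Xi_graph_0)
next
  case (Suc n)
  from Suc.prems obtain e v where "w = e # v" "v \<in> arcs (G n)" "e \<in> arcs (R (C n v))"
    by (rule arcs_SucE)
  then show ?case using Suc.IH rule_graph(5) by (auto simp: Xi_graph_Suc)
qed

lemma length_arc: "w \<in> arcs (G n) \<Longrightarrow> length w = n"
  by (induction n arbitrary: w) (auto simp: Xi_graph_0 Xi_graph_Suc)

lemma finite_arcs_Xi: "finite (arcs (G n))"
proof (induction n)
  case (Suc n)
  have "arcs (G (Suc n)) = (\<Union>w\<in>arcs (G n). (\<lambda>e. e # w) ` arcs (R (C n w)))"
    by (auto simp: Xi_graph_Suc)
  then show ?case
    using Suc arc_colour rule_graph(1) by (auto intro!: finite_imageI fin_digraph.finite_arcs)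
qed (simp add: Xi_graph_0)

lemma finite_verts_Xi: "finite (verts (G n))"
proof (induction n)
  case (Suc n)
  then show ?case
    using arc_colour rule_graph(1) finite_arcs_Xi
    by (auto simp: Xi_graph_Suc intro!: finite_imageI fin_digraph.finite_verts)
qed (simp add: Xi_graph_0)

lemma pl_eq:
  "pl n w (pos (C n w)) = tail (G n) w"
  "w \<in> arcs (G n) \<Longrightarrow> pl n w (neg (C n w)) = head (G n) w"
  "x \<noteq> pos (C n w) \<Longrightarrow> x \<noteq> neg (C n w) \<Longrightarrow> pl n w x = Planted w x"
  using arc_colour[of w n] rule_graph(8) by (force simp: plant_def Xi_graph_def)+

lemma wf_Xi: "wf_digraph (G n)"
proof (cases n)
  case 0
  then show ?thesis by (simp add: wf_digraph_def Xi_graph_0)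
next
  case (Suc m)
  have "tail (G (Suc m)) a \<in> verts (G (Suc m)) \<and> head (G (Suc m)) a \<in> verts (G (Suc m))"
    if "a \<in> arcs (G (Suc m))" for a
    using that
  proof (rule arcs_SucE)
    fix e w assume "a = e # w" "w \<in> arcs (G m)" "e \<in> arcs (R (C m w))"
    then show ?thesis using rule_wf[OF arc_colour, of w m e] by (auto simp: Xi_graph_Suc)
  qed
  then show ?thesis unfolding Suc by (simp add: wf_digraph_def)
qed

lemma Xi_arc_ends: "w \<in> arcs (G n) \<Longrightarrow> tail (G n) w \<in> verts (G n) \<and> head (G n) w \<in> verts (G n)"
  using wf_Xi by (simp add: wf_digraph_def)

lemma verts_mono: "m \<le> n \<Longrightarrow> verts (G m) \<subseteq> verts (G n)"
  by (rule lift_Suc_mono_le) (auto simp: Xi_graph_Suc)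

text \<open>The length of the stored address is the level whose replacement creates the vertex. This
  yields the freshness of the vertices planted into level \<open>n\<close>.\<close>

lemma Planted_in_verts: "Planted w x \<in> verts (G n) \<Longrightarrow> length w < n"
proof (induction n)
  case (Suc n)
  from Suc.prems consider "Planted w x \<in> verts (G n)"
    | v y where "v \<in> arcs (G n)" "Planted w x = pl n v y" by (auto simp: Xi_graph_Suc)
  then show ?case
  proof cases
    case (2 v y)
    show ?thesis
    proof (cases "y = pos (C n v) \<or> y = neg (C n v)")
      case True
      then have "Planted w x \<in> verts (G n)" using 2 Xi_arc_ends[of v n] by (auto simp: pl_eq)
      then show ?thesis using Suc.IH by simp
    next
      case False
      then show ?thesis using 2 by (simp add: pl_eq length_arc)
    qed
  qed (use Suc.IH in auto)
qed (simp add: Xi_graph_0)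

text \<open>Inner vertices of a copy are fresh, so an old vertex can only be the image of a planting
  vertex.\<close>

lemma pl_old_iff:
  assumes w: "w \<in> arcs (G n)" and v: "v \<in> verts (G n)"
  shows "pl n w x = v \<longleftrightarrow>
    x = pos (C n w) \<and> tail (G n) w = v \<or> x = neg (C n w) \<and> head (G n) w = v"
proof -
  have "Planted w x \<noteq> v" using Planted_in_verts[of w x n] length_arc[OF w] v by auto
  then show ?thesis using w rule_graph(8)[OF arc_colour[OF w]]
    by (cases "x = pos (C n w)"; cases "x = neg (C n w)") (auto simp: pl_eq)
qed

text \<open>A rule graph is connected and has a vertex other than \<open>x\<close>; a walk to it
  starts with an arc at \<open>x\<close>.\<close>

lemma rule_arc_at:
  assumes i: "i < K" and x: "x \<in> verts (R i)"
  shows "\<exists>e\<in>arcs (R i). tail (R i) e = x \<or> head (R i) e = x"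
proof -
  interpret U: wf_digraph "undirected (R i)" by (rule wf_undirected[OF rule_graph(2)[OF i]])
  from rule_graph(6-8)[OF i] obtain y where "y \<in> verts (R i)" "y \<noteq> x" by metis
  then obtain p where "U.awalk x p y"
    using ex_undirected_walk[OF rule_graph(2,4)[OF i] x] by auto
  then obtain z q where "U.awalk x (z # q) y" using \<open>y \<noteq> x\<close>
    by (cases p) (auto simp: U.awalk_Nil_iff)
  then show ?thesis by (cases z) (auto simp: U.awalk_Cons_iff split: if_splits)
qed

section \<open>Arcs at a vertex, their descendants and weighted degrees\<close>

definition incident :: "nat \<Rightarrow> ('v, 'e) eigs_vertex \<Rightarrow> 'e list set" where
  "incident n v = {w \<in> arcs (G n). tail (G n) w = v \<or> head (G n) w = v}"

lemma finite_incident: "finite (incident n v)"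
  unfolding incident_def using finite_arcs_Xi by simp

lemma incident_nonempty: "v \<in> verts (G n) \<Longrightarrow> incident n v \<noteq> {}"
proof (induction n)
  case 0
  then show ?case by (auto simp: Xi_graph_0 incident_def)
next
  case (Suc n)
  \<comment> \<open>An old vertex is the image of a planting vertex in the copy for an incident arc,
    so every vertex lies in some copy.\<close>
  obtain w x where wx: "w \<in> arcs (G n)" "x \<in> verts (R (C n w))" "v = pl n w x"
  proof (cases "v \<in> verts (G n)")
    case True
    with Suc.IH obtain w where "w \<in> arcs (G n)" "tail (G n) w = v \<or> head (G n) w = v"
      unfolding incident_def by auto
    then show ?thesis
      using that pl_eq(1)[of n w] pl_eq(2)[of w n] rule_graph(6,7)[OF arc_colour, of w n] by metis
  next
    case False
    then show ?thesis using Suc.prems that by (auto simp: Xi_graph_Suc)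
  qed
  from rule_arc_at[OF arc_colour[OF wx(1)] wx(2)] obtain e where
    "e \<in> arcs (R (C n w))" "tail (R (C n w)) e = x \<or> head (R (C n w)) e = x" by auto
  then have "e # w \<in> incident (Suc n) v"
    unfolding incident_def using wx by (auto simp: Xi_graph_Suc)
  then show ?case by auto
qed

text \<open>A crude common bound for the sizes of the rule graphs; it only matters that it is
  independent of the level.\<close>

definition arc_bound :: nat where
  "arc_bound = (\<Sum>i<K. card (arcs (R i)))"

lemma card_rule_arcs: "i < K \<Longrightarrow> card (arcs (R i)) \<le> arc_bound"
  unfolding arc_bound_def by (rule member_le_sum) auto

text \<open>Addresses list the most recent letter first, so \<open>drop l b\<close> is the arc of level \<open>m\<close> in whose
  copy \<open>b\<close> lies.\<close>

definition descendants :: "nat \<Rightarrow> 'e list set \<Rightarrow> nat \<Rightarrow> 'e list set" where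
  "descendants m I l = {b \<in> arcs (G (m + l)). drop l b \<in> I}"

lemma drop_arc: "b \<in> arcs (G (m + l)) \<Longrightarrow> drop l b \<in> arcs (G m)"
  by (induction l arbitrary: b) (auto elim!: arcs_SucE)

text \<open>An arc has one child per arc of its rule graph, hence at most \<open>arc_bound\<close>
  children.\<close>

lemma card_descendants:
  assumes "finite I"
  shows "card (descendants m I l) \<le> arc_bound ^ l * card I"
proof (induction l)
  case 0
  have "descendants m I 0 \<subseteq> I" by (auto simp: descendants_def)
  then show ?case using assms by (simp add: card_mono)
next
  case (Suc l)
  have fin: "finite (descendants m I l)" unfolding descendants_def using finite_arcs_Xi by simp
  have "descendants m I (Suc l)
    \<subseteq> (\<Union>b\<in>descendants m I l. (\<lambda>e. e # b) ` arcs (R (C (m + l) b)))" (is "_ \<subseteq> ?B")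
    by (auto simp: descendants_def elim!: arcs_SucE)
  moreover have "finite ?B"
    using fin arc_colour rule_graph(1)
    by (auto simp: descendants_def intro!: finite_imageI fin_digraph.finite_arcs)
  ultimately have "card (descendants m I (Suc l)) \<le> card ?B" by (rule card_mono[rotated])
  also have "\<dots> \<le> (\<Sum>b\<in>descendants m I l. card ((\<lambda>e. e # b) ` arcs (R (C (m + l) b))))"
    by (rule card_UN_le[OF fin])
  also have "\<dots> \<le> (\<Sum>b\<in>descendants m I l. arc_bound)"
    using card_rule_arcs arc_colour by (intro sum_mono) (auto simp: card_image inj_on_def descendants_def)
  also have "\<dots> \<le> arc_bound ^ Suc l * card I" using Suc.IH by (simp add: mult.commute mult.left_commute)
  finally show ?case .
qed

text \<open>The scalar product of the coloured degree vector of \<open>v\<close> in level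
  \<open>n\<close> with \<open>y\<close>: even indices belong to leaving arcs, odd indices to
  entering ones.\<close>

definition weighted_degree :: "(nat \<Rightarrow> real) \<Rightarrow> nat \<Rightarrow> ('v, 'e) eigs_vertex \<Rightarrow> real" where
  "weighted_degree y n v = (\<Sum>w\<in>arcs (G n).
     (if tail (G n) w = v then y (2 * C n w) else 0) +
     (if head (G n) w = v then y (2 * C n w + 1) else 0))"

lemma degree_matrix_carrier: "degree_matrix S \<in> carrier_mat (2 * K) (2 * K)"
  unfolding degree_matrix_def by simp

text \<open>Row \<open>r\<close> of the degree matrix belongs to the planting vertex
  \<open>b\<close>, and its product with \<open>y\<close> is the weighted degree of \<open>b\<close>
  inside the rule graph.\<close>

lemma degree_matrix_row:
  assumes i: "i < K" and b: "r = 2 * i \<and> b = pos i \<or> r = 2 * i + 1 \<and> b = neg i"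
  shows "(\<Sum>c<2 * K. real (degree_matrix S $$ (r, c)) * y c) =
    (\<Sum>e\<in>arcs (R i). (if tail (R i) e = b then y (2 * col i e) else 0) +
      (if head (R i) e = b then y (2 * col i e + 1) else 0))"
proof -
  have fin: "finite (arcs (R i))" using rule_graph(1)[OF i] by (rule fin_digraph.finite_arcs)
  have entry: "degree_matrix S $$ (r, c) = degree_vec K (rule S i) b $ c" if "c < 2 * K" for c
    using b i that unfolding degree_matrix_def by (auto simp: Let_def)
  have split: "(\<Sum>c<2 * m. h c) = (\<Sum>j<m. h (2 * j) + h (2 * j + 1))" for h :: "nat \<Rightarrow> real" and m
    by (induction m) (auto simp: algebra_simps)
  \<comment> \<open>Double counting: arcs grouped by colour against arcs taken one by one.\<close>
  have by_colour: "(\<Sum>j<K. real (card {e \<in> arcs (R i). col i e = j \<and> P e}) * h j)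
    = (\<Sum>e\<in>arcs (R i). if P e then h (col i e) else 0)" for P and h :: "nat \<Rightarrow> real"
  proof -
    have "real (card {e \<in> arcs (R i). col i e = j \<and> P e}) * h j
      = (\<Sum>e\<in>arcs (R i). if col i e = j then if P e then h j else 0 else 0)" for j
    proof -
      have "real (card {e \<in> arcs (R i). col i e = j \<and> P e}) * h j
        = (\<Sum>e\<in>{e \<in> arcs (R i). col i e = j \<and> P e}. h j)" by simp
      also have "\<dots> = (\<Sum>e\<in>arcs (R i). if col i e = j \<and> P e then h j else 0)"
        by (rule sum.inter_filter[OF fin])
      also have "\<dots> = (\<Sum>e\<in>arcs (R i). if col i e = j then if P e then h j else 0 else 0)"
        by (intro sum.cong) auto
      finally show ?thesis .
    qed
    then have "(\<Sum>j<K. real (card {e \<in> arcs (R i). col i e = j \<and> P e}) * h j)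
      = (\<Sum>j<K. \<Sum>e\<in>arcs (R i). if col i e = j then if P e then h j else 0 else 0)" by simp
    also have "\<dots> = (\<Sum>e\<in>arcs (R i). \<Sum>j<K. if col i e = j then if P e then h j else 0 else 0)"
      by (rule sum.swap)
    also have "\<dots> = (\<Sum>e\<in>arcs (R i). if P e then h (col i e) else 0)"
      using rule_graph(5)[OF i] by (intro sum.cong) (auto simp: sum.delta')
    finally show ?thesis .
  qed
  have "(\<Sum>c<2 * K. real (degree_matrix S $$ (r, c)) * y c)
    = (\<Sum>c<2 * K. real (degree_vec K (rule S i) b $ c) * y c)"
    using entry by (intro sum.cong) auto
  also have "\<dots> = (\<Sum>j<K. real (degree_vec K (rule S i) b $ (2 * j)) * y (2 * j)
      + real (degree_vec K (rule S i) b $ (2 * j + 1)) * y (2 * j + 1))" by (rule split)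
  also have "\<dots> = (\<Sum>j<K. real (card {e \<in> arcs (R i). col i e = j \<and> tail (R i) e = b}) * y (2 * j)
      + real (card {e \<in> arcs (R i). col i e = j \<and> head (R i) e = b}) * y (2 * j + 1))"
    by (intro sum.cong) (auto simp: degree_vec_def)
  also have "\<dots> = (\<Sum>e\<in>arcs (R i). (if tail (R i) e = b then y (2 * col i e) else 0) +
      (if head (R i) e = b then y (2 * col i e + 1) else 0))"
    using by_colour[of "\<lambda>e. tail (R i) e = b" "\<lambda>j. y (2 * j)"]
      by_colour[of "\<lambda>e. head (R i) e = b" "\<lambda>j. y (2 * j + 1)"]
    by (simp add: sum.distrib)
  finally show ?thesis .
qed

text \<open>Each arc at \<open>v\<close> is replaced by the arcs at the planting vertex identified
  with \<open>v\<close>. This multiplies its contribution by the eigenvalue.\<close>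

lemma weighted_degree_Suc:
  assumes eig: "\<And>r. r < 2 * K \<Longrightarrow> (\<Sum>c<2 * K. real (degree_matrix S $$ (r, c)) * y c) = s * y r"
    and v: "v \<in> verts (G n)"
  shows "weighted_degree y (Suc n) v = s * weighted_degree y n v"
proof -
  let ?D = "\<lambda>i b e. (if tail (R i) e = b then y (2 * col i e) else 0) +
      (if head (R i) e = b then y (2 * col i e + 1) else 0)"
  have row: "(\<Sum>e\<in>arcs (R i). ?D i (pos i) e) = s * y (2 * i)"
    "(\<Sum>e\<in>arcs (R i). ?D i (neg i) e) = s * y (2 * i + 1)" if "i < K" for i
    using degree_matrix_row[OF that, of "2 * i" "pos i" y] eig[of "2 * i"]
      degree_matrix_row[OF that, of "2 * i + 1" "neg i" y] eig[of "2 * i + 1"] that by auto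
  have arcs: "arcs (G (Suc n)) = (\<lambda>(w, e). e # w) ` (SIGMA w:arcs (G n). arcs (R (C n w)))"
    by (auto simp: Xi_graph_Suc)
  let ?T = "\<lambda>w e. (if pl n w (tail (R (C n w)) e) = v then y (2 * col (C n w) e) else 0) +
     (if pl n w (head (R (C n w)) e) = v then y (2 * col (C n w) e + 1) else 0)"
  have "weighted_degree y (Suc n) v
    = (\<Sum>(w, e)\<in>(SIGMA w:arcs (G n). arcs (R (C n w))). ?T w e)"
    unfolding weighted_degree_def arcs
    by (subst sum.reindex, force simp: inj_on_def)
      (rule sum.cong, auto simp del: sum.If_cases simp: Xi_graph_Suc)
  also have "\<dots> = (\<Sum>w\<in>arcs (G n). \<Sum>e\<in>arcs (R (C n w)). ?T w e)"
    using finite_arcs_Xi arc_colour rule_graph(1)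
    by (subst sum.Sigma) (auto intro: fin_digraph.finite_arcs)
  also have "\<dots> = (\<Sum>w\<in>arcs (G n). s * ((if tail (G n) w = v then y (2 * C n w) else 0) +
     (if head (G n) w = v then y (2 * C n w + 1) else 0)))"
  proof (rule sum.cong[OF refl])
    fix w assume w: "w \<in> arcs (G n)"
    let ?i = "C n w"
    have i: "?i < K" using w by (rule arc_colour)
    \<comment> \<open>As \<open>v\<close> is old, the copy meets it only in planting vertices; as
      these are distinct, the contributions of the two ends add up.\<close>
    have "?T w e = (if tail (G n) w = v then 1 else 0) * ?D ?i (pos ?i) e
        + (if head (G n) w = v then 1 else 0) * ?D ?i (neg ?i) e" for e
      using rule_graph(8)[OF i] by (auto simp: pl_old_iff[OF w v])
    then have "(\<Sum>e\<in>arcs (R ?i). ?T w e)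
      = (if tail (G n) w = v then 1 else 0) * (\<Sum>e\<in>arcs (R ?i). ?D ?i (pos ?i) e)
        + (if head (G n) w = v then 1 else 0) * (\<Sum>e\<in>arcs (R ?i). ?D ?i (neg ?i) e)"
      unfolding sum_distrib_left by (simp only: sum.distrib)
    then show "(\<Sum>e\<in>arcs (R ?i). ?T w e) = s * ((if tail (G n) w = v then y (2 * ?i) else 0) +
     (if head (G n) w = v then y (2 * ?i + 1) else 0))"
      unfolding row[OF i] by (simp add: algebra_simps)
  qed
  also have "\<dots> = s * weighted_degree y n v"
    unfolding weighted_degree_def by (rule sum_distrib_left[symmetric])
  finally show ?thesis .
qed

text \<open>An arc at \<open>v\<close> contributes at least one term, and at most one for each of
  its two ends.\<close>

lemma weighted_degree_bounds:
  fixes l h :: real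
  assumes "\<And>c. c < 2 * K \<Longrightarrow> l \<le> y c \<and> y c \<le> h" and "0 \<le> l"
  shows "l * card (incident n v) \<le> weighted_degree y n v"
    "weighted_degree y n v \<le> 2 * h * card (incident n v)"
proof -
  let ?t = "\<lambda>w. (if tail (G n) w = v then y (2 * C n w) else 0) +
     (if head (G n) w = v then y (2 * C n w + 1) else 0)"
  have eq: "weighted_degree y n v = (\<Sum>w\<in>incident n v. ?t w)"
    unfolding weighted_degree_def incident_def using finite_arcs_Xi
    by (intro sum.mono_neutral_right) auto
  have y: "l \<le> y (2 * C n w)" "l \<le> y (2 * C n w + 1)" "y (2 * C n w) \<le> h" "y (2 * C n w + 1) \<le> h"
    if "w \<in> incident n v" for w
    using assms(1)[of "2 * C n w"] assms(1)[of "2 * C n w + 1"] arc_colour[of w n] that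
    by (auto simp: incident_def)
  have "(\<Sum>w\<in>incident n v. l) \<le> (\<Sum>w\<in>incident n v. ?t w)"
    using y \<open>0 \<le> l\<close> by (intro sum_mono) (force simp: incident_def)
  then show "l * card (incident n v) \<le> weighted_degree y n v" unfolding eq by (simp add: mult.commute)
  have "(\<Sum>w\<in>incident n v. ?t w) \<le> (\<Sum>w\<in>incident n v. 2 * h)"
    using y \<open>0 \<le> l\<close> by (intro sum_mono) (force simp: incident_def)
  then show "weighted_degree y n v \<le> 2 * h * card (incident n v)" unfolding eq
    by (simp add: mult.commute)
qed

end

section \<open>Potentials and distances\<close>

text \<open>The metric arguments need only these facts: in each rule graph the weighted distance of
  the planting vertices is \<rho> times the weight of the replaced arc. The Perron vector of a
  minimising distance matrix supplies \<open>u\<close>.\<close>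

locale eigs_metric = eigs_system S for S :: "('v, 'e) eigs" +
  fixes u :: "nat \<Rightarrow> real" and \<rho> :: real
  assumes u_pos: "i < K \<Longrightarrow> 0 < u i"
    and path_cost_ge: "i < K \<Longrightarrow> simple_path (R i) (pos i) p (neg i) \<Longrightarrow>
      \<rho> * u i \<le> walk_cost (\<lambda>e. u (col i e)) p"
    and ex_path_cost: "i < K \<Longrightarrow>
      \<exists>p. simple_path (R i) (pos i) p (neg i) \<and> walk_cost (\<lambda>e. u (col i e)) p = \<rho> * u i"
    and rho_ge_2: "2 \<le> \<rho>"
begin

abbreviation \<omega> :: "nat \<Rightarrow> 'e list \<Rightarrow> real" where "\<omega> n \<equiv> \<lambda>w. u (C n w)"

definition u_min :: real where "u_min = Min (u ` {..<K})"
definition u_max :: real where "u_max = Max (u ` {..<K})"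

lemma u_bounds: "i < K \<Longrightarrow> u_min \<le> u i" "i < K \<Longrightarrow> u i \<le> u_max"
  unfolding u_min_def u_max_def by auto

lemma u_min_pos: "0 < u_min"
  unfolding u_min_def using u_pos K_pos by (subst Min_gr_iff) auto

lemma u_max_pos: "0 < u_max"
  using u_min_pos u_bounds[OF K_pos] by linarith

section \<open>Extension of potentials and lower bounds for distances\<close>

lemma ex_rule_potential:
  assumes i: "i < K"
  shows "\<exists>h. lipschitz_arcs (R i) (\<lambda>e. u (col i e)) h \<and> h (pos i) = 0 \<and> h (neg i) = \<rho> * u i \<and>
    (\<forall>x\<in>verts (R i). 0 \<le> h x \<and> h x \<le> \<rho> * u i)"
  using rule_graph[OF i] u_pos path_cost_ge[OF i] rho_ge_2 i
  by (intro ex_potential) (auto intro!: less_imp_le)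

text \<open>A potential on level \<open>n\<close>, scaled by \<open>\<rho>\<close>, extends to level \<open>n + 1\<close>: inside the copy of a rule graph
  it is the minimum of two potentials that grow from either planting vertex at unit speed.\<close>

lemma lipschitz_extend:
  assumes lip: "lipschitz_arcs (G n) (\<omega> n) f"
  shows "\<exists>f'. lipschitz_arcs (G (Suc n)) (\<omega> (Suc n)) f' \<and>
    (\<forall>v\<in>verts (G n). f' v = \<rho> * f v) \<and>
    (\<forall>w\<in>arcs (G n). \<forall>x\<in>verts (R (C n w)).
       \<rho> * min (f (tail (G n) w)) (f (head (G n) w)) \<le> f' (pl n w x))"
proof -
  obtain h where h: "\<And>i. i < K \<Longrightarrow> lipschitz_arcs (R i) (\<lambda>e. u (col i e)) (h i)"
    "\<And>i. i < K \<Longrightarrow> h i (pos i) = 0" "\<And>i. i < K \<Longrightarrow> h i (neg i) = \<rho> * u i"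
    "\<And>i x. i < K \<Longrightarrow> x \<in> verts (R i) \<Longrightarrow> 0 \<le> h i x \<and> h i x \<le> \<rho> * u i"
    using ex_rule_potential by metis
  define g where "g w x = min (\<rho> * f (tail (G n) w) + h (C n w) x)
    (\<rho> * f (head (G n) w) + \<rho> * u (C n w) - h (C n w) x)" for w x
  \<comment> \<open>The default 0 concerns only the initial vertices, which belong to every level
    anyway.\<close>
  define f' where "f' v = (if v \<in> verts (G n) then \<rho> * f v
    else case v of Planted w x \<Rightarrow> g w x | _ \<Rightarrow> 0)" for v
  have f'_pl: "f' (pl n w x) = g w x" if w: "w \<in> arcs (G n)" and x: "x \<in> verts (R (C n w))" for w x
  proof -
    have i: "C n w < K" using w by (rule arc_colour)
    \<comment> \<open>The Lipschitz bound across \<open>w\<close> decides which term of the minimum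
      is attained at each planting vertex, so \<open>g\<close> agrees there with the scaled old
      values.\<close>
    have "\<rho> * f (tail (G n) w) \<le> \<rho> * (f (head (G n) w) + u (C n w))"
      "\<rho> * f (head (G n) w) \<le> \<rho> * (f (tail (G n) w) + u (C n w))"
      using lipschitz_arcsD[OF lip w] rho_ge_2 by (auto intro!: mult_left_mono)
    note le = this[unfolded distrib_left]
    consider "x = pos (C n w)" | "x = neg (C n w)" | "x \<noteq> pos (C n w)" "x \<noteq> neg (C n w)" by blast
    then show ?thesis
    proof cases
      case 1
      then show ?thesis using le h(2)[OF i] Xi_arc_ends[OF w] by (simp add: pl_eq f'_def g_def min_def)
    next
      case 2
      then show ?thesis using le h(3)[OF i] Xi_arc_ends[OF w] w
        by (simp add: pl_eq f'_def g_def min_def)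
    next
      case 3
      then have "pl n w x \<notin> verts (G n)" using w pl_old_iff by blast
      then show ?thesis using 3 by (simp add: pl_eq f'_def)
    qed
  qed
  have "lipschitz_arcs (G (Suc n)) (\<omega> (Suc n)) f'"
    unfolding lipschitz_arcs_def
  proof
    fix a assume "a \<in> arcs (G (Suc n))"
    then obtain e w where a: "a = e # w" "w \<in> arcs (G n)" "e \<in> arcs (R (C n w))" by (rule arcs_SucE)
    have i: "C n w < K" using a(2) by (rule arc_colour)
    from lipschitz_arcsD[OF h(1)[OF i] a(3)] rule_wf[OF i a(3)]
    show "\<bar>f' (tail (G (Suc n)) a) - f' (head (G (Suc n)) a)\<bar> \<le> \<omega> (Suc n) a"
      unfolding a(1) by (simp add: Xi_graph_Suc f'_pl[OF a(2)] g_def min_def) linarith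
  qed
  moreover have "\<rho> * min (f (tail (G n) w)) (f (head (G n) w)) \<le> f' (pl n w x)"
    if w: "w \<in> arcs (G n)" and x: "x \<in> verts (R (C n w))" for w x
  proof -
    have "\<rho> * min (f (tail (G n) w)) (f (head (G n) w)) \<le> \<rho> * f (tail (G n) w)"
      "\<rho> * min (f (tail (G n) w)) (f (head (G n) w)) \<le> \<rho> * f (head (G n) w)"
      using rho_ge_2 by (auto intro!: mult_left_mono)
    then show ?thesis
      using h(4)[OF arc_colour[OF w] x] by (auto simp: f'_pl[OF w x] g_def)
  qed
  moreover have "\<forall>v\<in>verts (G n). f' v = \<rho> * f v" by (simp add: f'_def)
  ultimately show ?thesis by blast
qed

text \<open>The last clause keeps a potential large on all descendants of an arc at whose ends it
  was large; it is what localises balls.\<close>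

lemma lipschitz_extend_iter:
  assumes lip: "lipschitz_arcs (G m) (\<omega> m) f"
  shows "\<exists>f'. lipschitz_arcs (G (m + l)) (\<omega> (m + l)) f' \<and>
    (\<forall>v\<in>verts (G m). f' v = \<rho> ^ l * f v) \<and>
    (\<forall>b\<in>arcs (G (m + l)). \<rho> ^ l * min (f (tail (G m) (drop l b))) (f (head (G m) (drop l b)))
       \<le> min (f' (tail (G (m + l)) b)) (f' (head (G (m + l)) b)))"
proof (induction l)
  case 0
  then show ?case using lip by (intro exI[of _ f]) simp
next
  case (Suc l)
  then obtain f' where f': "lipschitz_arcs (G (m + l)) (\<omega> (m + l)) f'"
    "\<And>v. v \<in> verts (G m) \<Longrightarrow> f' v = \<rho> ^ l * f v"
    "\<And>b. b \<in> arcs (G (m + l)) \<Longrightarrow>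
      \<rho> ^ l * min (f (tail (G m) (drop l b))) (f (head (G m) (drop l b)))
       \<le> min (f' (tail (G (m + l)) b)) (f' (head (G (m + l)) b))" by blast
  from lipschitz_extend[OF f'(1)] obtain f'' where
    f'': "lipschitz_arcs (G (Suc (m + l))) (\<omega> (Suc (m + l))) f''"
    "\<And>v. v \<in> verts (G (m + l)) \<Longrightarrow> f'' v = \<rho> * f' v"
    "\<And>w x. w \<in> arcs (G (m + l)) \<Longrightarrow> x \<in> verts (R (C (m + l) w)) \<Longrightarrow>
       \<rho> * min (f' (tail (G (m + l)) w)) (f' (head (G (m + l)) w)) \<le> f'' (pl (m + l) w x)" by blast
  have "\<rho> ^ Suc l * min (f (tail (G m) (drop (Suc l) a))) (f (head (G m) (drop (Suc l) a)))
       \<le> min (f'' (tail (G (Suc (m + l))) a)) (f'' (head (G (Suc (m + l))) a))"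
    if a: "a \<in> arcs (G (Suc (m + l)))" for a
  proof -
    from a obtain e b where b: "a = e # b" "b \<in> arcs (G (m + l))" "e \<in> arcs (R (C (m + l) b))"
      by (rule arcs_SucE)
    have "\<rho> * (\<rho> ^ l * min (f (tail (G m) (drop l b))) (f (head (G m) (drop l b))))
      \<le> \<rho> * min (f' (tail (G (m + l)) b)) (f' (head (G (m + l)) b))"
      using f'(3)[OF b(2)] rho_ge_2 by (intro mult_left_mono) auto
    moreover have "\<dots> \<le> f'' (tail (G (Suc (m + l))) a)" "\<dots> \<le> f'' (head (G (Suc (m + l))) a)"
      using f''(3)[OF b(2)] rule_wf[OF arc_colour[OF b(2)] b(3)] by (auto simp: b(1) Xi_graph_Suc)
    ultimately show ?thesis by (simp add: b(1) mult.assoc)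
  qed
  moreover have "f'' v = \<rho> ^ Suc l * f v" if "v \<in> verts (G m)" for v
    using that verts_mono[of m "m + l"] f''(2) f'(2) by auto
  ultimately show ?case using f''(1) by auto
qed

lemma \<omega>_bounds: "w \<in> arcs (G n) \<Longrightarrow> u_min \<le> \<omega> n w" "w \<in> arcs (G n) \<Longrightarrow> \<omega> n w \<le> u_max"
  using u_bounds arc_colour by auto

lemma graph_dist_init_ge:
  "ereal (\<rho> ^ n * (u (init_colour S) / u_max)) \<le> graph_dist (G n) Init_Plus Init_Minus"
proof -
  \<comment> \<open>The steepest potential on the initial edge; each level multiplies its increment
    by \<rho>.\<close>
  define f where "f v = (if v = Init_Minus then u (init_colour S) else 0)"
    for v :: "('v, 'e) eigs_vertex"
  have "lipschitz_arcs (G 0) (\<omega> 0) f"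
    using u_pos[OF init_colour] by (simp add: lipschitz_arcs_def Xi_graph_0 f_def)
  from lipschitz_extend_iter[OF this, of n] obtain f' where
    f': "lipschitz_arcs (G n) (\<omega> n) f'" "\<And>v. v \<in> verts (G 0) \<Longrightarrow> f' v = \<rho> ^ n * f v" by auto
  have "ereal ((f' Init_Minus - f' Init_Plus) / u_max) \<le> graph_dist (G n) Init_Plus Init_Minus"
    using wf_Xi f'(1) \<omega>_bounds(2) u_max_pos by (rule graph_dist_ge)
  then show ?thesis by (simp add: f'(2) f_def Xi_graph_0)
qed

text \<open>After \<open>l\<close> levels, the potential that vanishes only at \<open>v\<close> has
  reached at least \<open>r * u_max\<close> on all arcs that do not descend from an arc at
  \<open>v\<close>.\<close>

lemma graph_ball_subset:
  assumes v: "v \<in> verts (G m)" and l: "r * u_max \<le> \<rho> ^ l * u_min"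
  defines "A \<equiv> descendants m (incident m v) l"
  shows "graph_ball (G (m + l)) v r \<subseteq> insert v (tail (G (m + l)) ` A \<union> head (G (m + l)) ` A)"
proof
  fix x assume x: "x \<in> graph_ball (G (m + l)) v r"
  \<comment> \<open>The height \<open>u_min\<close> is admissible because every arc weighs at least
    that much.\<close>
  define f where "f y = (if y = v then 0 else u_min)" for y
  have "lipschitz_arcs (G m) (\<omega> m) f"
    using \<omega>_bounds u_min_pos by (force simp: lipschitz_arcs_def f_def)
  from lipschitz_extend_iter[OF this, of l] obtain f' where
    f': "lipschitz_arcs (G (m + l)) (\<omega> (m + l)) f'" "f' v = 0"
    "\<And>b. b \<in> arcs (G (m + l)) \<Longrightarrow>
      \<rho> ^ l * min (f (tail (G m) (drop l b))) (f (head (G m) (drop l b)))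
       \<le> min (f' (tail (G (m + l)) b)) (f' (head (G (m + l)) b))"
    using v unfolding f_def by fastforce
  have "x \<in> verts (G (m + l))" using x by (simp add: graph_ball_def)
  then obtain b where b: "b \<in> incident (m + l) x" using incident_nonempty by blast
  then have b_arc: "b \<in> arcs (G (m + l))" by (simp add: incident_def)
  have "drop l b \<in> incident m v"
  proof (rule ccontr)
    assume "drop l b \<notin> incident m v"
    then have "f (tail (G m) (drop l b)) = u_min" "f (head (G m) (drop l b)) = u_min"
      using drop_arc[OF b_arc] by (auto simp: incident_def f_def)
    then have "\<rho> ^ l * u_min \<le> f' x" using f'(3)[OF b_arc] b by (auto simp: incident_def)
    then have "r * u_max \<le> f' x - f' v" using l f'(2) by simp
    then have "r \<le> (f' x - f' v) / u_max" using u_max_pos by (simp add: field_simps)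
    also have "ereal ((f' x - f' v) / u_max) \<le> graph_dist (G (m + l)) v x"
      using wf_Xi f'(1) \<omega>_bounds(2) u_max_pos by (rule graph_dist_ge)
    finally show False using x by (auto simp: graph_ball_def)
  qed
  then have "b \<in> A" unfolding A_def descendants_def using b_arc by simp
  then show "x \<in> insert v (tail (G (m + l)) ` A \<union> head (G (m + l)) ` A)"
    using b by (auto simp: incident_def)
qed

lemma card_graph_ball_le:
  assumes "v \<in> verts (G m)" "r * u_max \<le> \<rho> ^ l * u_min"
  shows "card (graph_ball (G (m + l)) v r) \<le> 1 + 2 * (arc_bound ^ l * card (incident m v))"
proof -
  let ?A = "descendants m (incident m v) l"
  have fin: "finite ?A" unfolding descendants_def using finite_arcs_Xi by simp
  have "card (graph_ball (G (m + l)) v r)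
    \<le> card (insert v (tail (G (m + l)) ` ?A \<union> head (G (m + l)) ` ?A))"
    using graph_ball_subset[OF assms] fin by (intro card_mono) auto
  also have "\<dots> \<le> 1 + (card ?A + card ?A)"
    using fin by (intro card_insert_le_m1[THEN order_trans] order_refl)
      (auto intro!: order_trans[OF card_Un_le] add_mono card_image_le)
  also have "\<dots> \<le> 1 + 2 * (arc_bound ^ l * card (incident m v))"
    using card_descendants[OF finite_incident, of m m v l] by simp
  finally show ?thesis .
qed

section \<open>Substitution of walks and upper bounds for distances\<close>

lemma within_cost_copy:
  assumes w: "w \<in> arcs (G n)" and p: "pre_digraph.awalk (undirected (R (C n w))) a p b"
  shows "within_cost (G (Suc n)) (\<omega> (Suc n)) (pl n w a) (pl n w b)
    (walk_cost (\<lambda>e. u (col (C n w) e)) p)"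
proof (rule within_cost_by_steps[OF _ wf_Xi p])
  show "wf_digraph (R (C n w))" using rule_graph(2) arc_colour[OF w] by blast
  show "pl n w x \<in> verts (G (Suc n))" if "x \<in> verts (R (C n w))" for x
    using that w by (auto simp: Xi_graph_Suc)
  fix e assume "e \<in> arcs (R (C n w))"
  then have "e # w \<in> arcs (G (Suc n))" using w by (auto simp: Xi_graph_Suc)
  from within_cost_arc[OF wf_Xi this, of "\<omega> (Suc n)"]
  show "within_cost (G (Suc n)) (\<omega> (Suc n)) (pl n w (tail (R (C n w)) e)) (pl n w (head (R (C n w)) e))
      (u (col (C n w) e)) \<and>
    within_cost (G (Suc n)) (\<omega> (Suc n)) (pl n w (head (R (C n w)) e)) (pl n w (tail (R (C n w)) e))
      (u (col (C n w) e))" by (simp add: Xi_graph_Suc)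
qed

text \<open>Each arc is replaced by an optimal path through its rule graph, which costs exactly
  \<rho> times as much.\<close>

lemma within_cost_Suc:
  assumes "within_cost (G n) (\<omega> n) a b c"
  shows "within_cost (G (Suc n)) (\<omega> (Suc n)) a b (\<rho> * c)"
proof -
  from assms obtain p where p: "pre_digraph.awalk (undirected (G n)) a p b" "walk_cost (\<omega> n) p \<le> c"
    unfolding within_cost_def by auto
  have "within_cost (G (Suc n)) (\<omega> (Suc n)) a b (walk_cost (\<lambda>w. \<rho> * \<omega> n w) p)"
  proof (rule within_cost_by_steps[OF wf_Xi wf_Xi p(1), where \<phi>="\<lambda>x. x"])
    show "x \<in> verts (G (Suc n))" if "x \<in> verts (G n)" for x using that by (simp add: Xi_graph_Suc)
    fix w assume w: "w \<in> arcs (G n)"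
    from ex_path_cost[OF arc_colour[OF w]] obtain q where
      q: "simple_path (R (C n w)) (pos (C n w)) q (neg (C n w))"
      "walk_cost (\<lambda>e. u (col (C n w) e)) q = \<rho> * u (C n w)" by auto
    have "within_cost (G (Suc n)) (\<omega> (Suc n)) (tail (G n) w) (head (G n) w) (\<rho> * \<omega> n w)"
      using within_cost_copy[OF w, of "pos (C n w)" q "neg (C n w)"] q w
      by (simp add: simple_path_def pre_digraph.apath_def pl_eq)
    with within_cost_sym[OF wf_Xi this]
    show "within_cost (G (Suc n)) (\<omega> (Suc n)) (tail (G n) w) (head (G n) w) (\<rho> * \<omega> n w) \<and>
      within_cost (G (Suc n)) (\<omega> (Suc n)) (head (G n) w) (tail (G n) w) (\<rho> * \<omega> n w)" by blast
  qed
  moreover have "walk_cost (\<lambda>w. \<rho> * \<omega> n w) p = \<rho> * walk_cost (\<omega> n) p"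
    by (simp add: sum_list_const_mult[symmetric] case_prod_unfold)
  then have "walk_cost (\<lambda>w. \<rho> * \<omega> n w) p \<le> \<rho> * c"
    using p(2) rho_ge_2 by (simp add: mult_left_mono)
  ultimately show ?thesis by (rule within_cost_mono)
qed

lemma ex_rule_cost_bound:
  "\<exists>B. \<forall>i<K. \<forall>x\<in>verts (R i). \<exists>p. pre_digraph.awalk (undirected (R i)) (pos i) p x \<and>
     walk_cost (\<lambda>e. u (col i e)) p \<le> B"
proof -
  have "\<exists>p. pre_digraph.awalk (undirected (R i)) (pos i) p x" if "i < K" "x \<in> verts (R i)" for i x
    using ex_undirected_walk[OF rule_graph(2,4,6)] that by blast
  then obtain P where P: "\<And>i x. i < K \<Longrightarrow> x \<in> verts (R i) \<Longrightarrow>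
    pre_digraph.awalk (undirected (R i)) (pos i) (P i x) x" by metis
  let ?c = "\<lambda>i x. walk_cost (\<lambda>e. u (col i e)) (P i x)"
  have nonneg: "0 \<le> ?c i x" if "i < K" "x \<in> verts (R i)" for i x
    using P[OF that] rule_graph(5)[OF that(1)] u_pos
    by (intro walk_cost_nonneg) (auto intro: less_imp_le)
  have fin: "finite (verts (R i))" if "i < K" for i
    using rule_graph(1)[OF that] by (rule fin_digraph.finite_verts)
  \<comment> \<open>The sum of all the finitely many nonnegative costs is a convenient common
    bound.\<close>
  have "?c i x \<le> (\<Sum>j<K. \<Sum>y\<in>verts (R j). ?c j y)" if "i < K" "x \<in> verts (R i)" for i x
  proof -
    have "?c i x \<le> (\<Sum>y\<in>verts (R i). ?c i y)"
      using that fin nonneg by (intro member_le_sum) auto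
    also have "\<dots> \<le> (\<Sum>j<K. \<Sum>y\<in>verts (R j). ?c j y)"
      using that nonneg by (intro member_le_sum[of i "{..<K}" "\<lambda>j. \<Sum>y\<in>verts (R j). ?c j y"])
        (auto intro!: sum_nonneg)
    finally show ?thesis .
  qed
  with P show ?thesis by blast
qed

text \<open>One level turns a bound \<open>c\<close> into \<open>\<rho> * c + B\<close>: an old
  vertex is reached first, then a copy is entered. The form \<open>B * (2 * \<rho> ^ n - 1)\<close>
  is stable under this recursion because \<open>2 \<le> \<rho>\<close>.\<close>

lemma ex_cost_to_init:
  "\<exists>B>0. \<forall>n. \<forall>v\<in>verts (G n). within_cost (G n) (\<omega> n) Init_Plus v (B * (2 * \<rho> ^ n - 1))"
proof -
  obtain B0 where B0: "\<And>i x. i < K \<Longrightarrow> x \<in> verts (R i) \<Longrightarrow>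
    \<exists>p. pre_digraph.awalk (undirected (R i)) (pos i) p x \<and> walk_cost (\<lambda>e. u (col i e)) p \<le> B0"
    using ex_rule_cost_bound by blast
  \<comment> \<open>\<open>B0\<close> serves the walks inside a copy, \<open>u_max\<close> the
    initial edge.\<close>
  define B where "B = max B0 u_max"
  have B: "0 < B" "B0 \<le> B" "u_max \<le> B" using u_max_pos by (auto simp: B_def)
  have "within_cost (G n) (\<omega> n) Init_Plus v (B * (2 * \<rho> ^ n - 1))" if "v \<in> verts (G n)" for n v
    using that
  proof (induction n arbitrary: v)
    case 0
    have "within_cost (G 0) (\<omega> 0) Init_Plus Init_Plus 0"
      by (rule within_cost_refl) (simp add: Xi_graph_0)
    moreover have "within_cost (G 0) (\<omega> 0) Init_Plus Init_Minus (u (init_colour S))"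
      using within_cost_arc(1)[OF wf_Xi, of "[]" 0 "\<omega> 0"] by (simp add: Xi_graph_0)
    moreover have "u (init_colour S) \<le> B" using u_bounds(2)[OF init_colour] B by linarith
    ultimately show ?case using 0 B by (auto simp: Xi_graph_0 intro: within_cost_mono)
  next
    case (Suc n)
    have old: "within_cost (G (Suc n)) (\<omega> (Suc n)) Init_Plus v (\<rho> * (B * (2 * \<rho> ^ n - 1)))"
      if "v \<in> verts (G n)" for v
      using within_cost_Suc[OF Suc.IH[OF that]] .
    have "\<rho> * (B * (2 * \<rho> ^ n - 1)) + B = B * (2 * \<rho> ^ Suc n - 1) - (\<rho> - 2) * B"
      by (simp add: algebra_simps)
    then have le: "\<rho> * (B * (2 * \<rho> ^ n - 1)) + B \<le> B * (2 * \<rho> ^ Suc n - 1)"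
      using rho_ge_2 B by simp
    from Suc.prems consider "v \<in> verts (G n)"
      | w x where "w \<in> arcs (G n)" "x \<in> verts (R (C n w))" "v = pl n w x"
      by (auto simp: Xi_graph_Suc)
    then show ?case
    proof cases
      case 1
      from old[OF this] show ?thesis by (rule within_cost_mono) (use le B in linarith)
    next
      case (2 w x)
      from B0[OF arc_colour[OF 2(1)] 2(2)] obtain p where
        p: "pre_digraph.awalk (undirected (R (C n w))) (pos (C n w)) p x"
        "walk_cost (\<lambda>e. u (col (C n w) e)) p \<le> B0" by blast
      have "within_cost (G (Suc n)) (\<omega> (Suc n)) (tail (G n) w) v B"
        using within_cost_copy[OF 2(1) p(1)] unfolding 2(3) pl_eq(1)
        by (rule within_cost_mono) (use p B in linarith)
      with old[of "tail (G n) w"] Xi_arc_ends[OF 2(1)]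
      have "within_cost (G (Suc n)) (\<omega> (Suc n)) Init_Plus v (\<rho> * (B * (2 * \<rho> ^ n - 1)) + B)"
        by (blast intro: within_cost_trans[OF wf_Xi])
      then show ?thesis using le by (rule within_cost_mono)
    qed
  qed
  with B(1) show ?thesis by blast
qed

lemma graph_diam_bounds:
  "\<exists>a>0. \<exists>b>0. \<forall>n. a * \<rho> ^ n \<le> graph_diam (G n) \<and> graph_diam (G n) \<le> b * \<rho> ^ n"
proof -
  obtain B where B: "0 < B" "\<And>n v. v \<in> verts (G n) \<Longrightarrow>
    within_cost (G n) (\<omega> n) Init_Plus v (B * (2 * \<rho> ^ n - 1))" using ex_cost_to_init by blast
  define a where "a = u (init_colour S) / u_max"
  \<comment> \<open>Two legs through \<open>Init_Plus\<close>, each of cost at most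
    \<open>2 * B * \<rho> ^ n\<close>; division by \<open>u_min\<close> turns costs into numbers of
    arcs.\<close>
  define b where "b = 4 * B / u_min"
  have ab: "0 < a" "0 < b"
    unfolding a_def b_def using u_pos[OF init_colour] u_max_pos u_min_pos B by auto
  have "a * \<rho> ^ n \<le> graph_diam (G n) \<and> graph_diam (G n) \<le> b * \<rho> ^ n" for n
  proof -
    let ?s = "SUP (x, y) \<in> verts (G n) \<times> verts (G n). graph_dist (G n) x y"
    have init: "(Init_Plus, Init_Minus) \<in> verts (G n) \<times> verts (G n)"
      using verts_mono[of 0 n] by (auto simp: Xi_graph_0)
    have "ereal (a * \<rho> ^ n) \<le> graph_dist (G n) Init_Plus Init_Minus"
      using graph_dist_init_ge[of n] by (simp add: a_def mult.commute)
    also have "\<dots> \<le> ?s" using SUP_upper[OF init, of "\<lambda>(x, y). graph_dist (G n) x y"] by simp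
    finally have lo: "ereal (a * \<rho> ^ n) \<le> ?s" .
    have hi: "?s \<le> ereal (b * \<rho> ^ n)"
    proof (rule SUP_least, clarify)
      fix x y assume xy: "x \<in> verts (G n)" "y \<in> verts (G n)"
      have "within_cost (G n) (\<omega> n) x y (B * (2 * \<rho> ^ n - 1) + B * (2 * \<rho> ^ n - 1))"
        by (rule within_cost_trans[OF wf_Xi within_cost_sym[OF wf_Xi B(2)[OF xy(1)]] B(2)[OF xy(2)]])
      then have "within_cost (G n) (\<omega> n) x y (4 * B * \<rho> ^ n)"
        by (rule within_cost_mono) (use B in \<open>simp add: algebra_simps\<close>)
      from graph_dist_le[OF wf_Xi this \<omega>_bounds(1) u_min_pos]
      show "graph_dist (G n) x y \<le> ereal (b * \<rho> ^ n)" by (simp add: b_def)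
    qed
    \<comment> \<open>The bounds confine the supremum to finite values, where
      \<open>real_of_ereal\<close> respects the order.\<close>
    from lo hi show ?thesis unfolding graph_diam_def
      by (cases ?s) auto
  qed
  with ab show ?thesis by blast
qed

end

section \<open>A lower bound for the size of balls\<close>

context eigs_system begin

text \<open>In the copy replacing an arc at \<open>v\<close>, some neighbour of \<open>v\<close> is
  an inner vertex. Different arcs give different neighbours, since \<open>Planted\<close> records
  the address.\<close>

lemma card_incident_le_ball:
  assumes v: "v \<in> verts (G n)" and r: "1 < r"
    and no_edge: "\<And>i e. i < K \<Longrightarrow> e \<in> arcs (R i) \<Longrightarrow> {tail (R i) e, head (R i) e} \<noteq> {pos i, neg i}"
  shows "card (incident n v) \<le> card (graph_ball (G (Suc n)) v r)"
proof -
  have "\<exists>x. Planted w x \<in> graph_ball (G (Suc n)) v r" if w: "w \<in> incident n v" for w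
  proof -
    have w_arc: "w \<in> arcs (G n)" using w by (simp add: incident_def)
    let ?i = "C n w"
    have i: "?i < K" by (rule arc_colour[OF w_arc])
    obtain b where b: "b \<in> {pos ?i, neg ?i}" "pl n w b = v"
      using w pl_eq(1)[of n w] pl_eq(2)[OF w_arc] by (auto simp: incident_def)
    then have "b \<in> verts (R ?i)" using rule_graph(6,7)[OF i] by auto
    from rule_arc_at[OF i this] obtain e where
      e: "e \<in> arcs (R ?i)" "tail (R ?i) e = b \<or> head (R ?i) e = b" by blast
    \<comment> \<open>The other end of \<open>e\<close>; it is an inner vertex because no arc joins
      the two planting vertices.\<close>
    define x where "x = (if tail (R ?i) e = b then head (R ?i) e else tail (R ?i) e)"
    have ends: "{tail (R ?i) e, head (R ?i) e} = {b, x}" using e(2) by (auto simp: x_def)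
    have "tail (R ?i) e \<noteq> head (R ?i) e"
      using loopfree_digraph.no_loops[OF rule_graph(3)[OF i] e(1)] .
    then have "x \<noteq> b" using e(2) by (auto simp: x_def)
    then have x: "x \<noteq> pos ?i" "x \<noteq> neg ?i"
      using no_edge[OF i e(1)] b(1) unfolding ends by auto
    have arc: "e # w \<in> arcs (G (Suc n))" using e w_arc by (auto simp: Xi_graph_Suc)
    have "within_cost (G (Suc n)) (\<lambda>_. 1) v (pl n w x) 1"
      using within_cost_arc[OF wf_Xi arc, of "\<lambda>_. 1"] e(2)
      by (auto simp: Xi_graph_Suc x_def simp flip: b(2))
    from graph_dist_le[OF wf_Xi this, of 1] have "graph_dist (G (Suc n)) v (pl n w x) \<le> 1"
      by (simp add: one_ereal_def)
    also have "\<dots> < ereal r" using r by (simp add: one_ereal_def)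
    finally have "graph_dist (G (Suc n)) v (pl n w x) < ereal r" .
    moreover have "pl n w x \<in> verts (G (Suc n))"
      using Xi_arc_ends[OF arc] e(2) by (auto simp: Xi_graph_Suc x_def split: if_splits)
    ultimately show ?thesis using x by (auto simp: graph_ball_def pl_eq)
  qed
  then obtain X where X: "\<And>w. w \<in> incident n v \<Longrightarrow> Planted w (X w) \<in> graph_ball (G (Suc n)) v r"
    by metis
  show ?thesis
  proof (rule card_inj_on_le)
    show "inj_on (\<lambda>w. Planted w (X w)) (incident n v)" by (auto simp: inj_on_def)
    show "(\<lambda>w. Planted w (X w)) ` incident n v \<subseteq> graph_ball (G (Suc n)) v r" using X by auto
    show "finite (graph_ball (G (Suc n)) v r)"
      unfolding graph_ball_def using finite_verts_Xi by simp
  qed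
qed

end

section \<open>Growth rates\<close>

context eigs_system begin

abbreviation rule_path :: "nat \<Rightarrow> ('e \<times> bool) list \<Rightarrow> bool" where
  "rule_path i p \<equiv> simple_path (R i) (pos i) p (neg i)"

definition path_matrix :: "(nat \<Rightarrow> ('e \<times> bool) list) \<Rightarrow> nat mat" where
  "path_matrix P = mat K K (\<lambda>(i, j). length (filter (\<lambda>(e, _). col i e = j) (P i)))"

lemma distance_matrices_eq: "distance_matrices S = {path_matrix P | P. \<forall>i<K. rule_path i (P i)}"
  unfolding distance_matrices_def path_matrix_def ..

lemma path_matrix_carrier: "path_matrix P \<in> carrier_mat K K"
  by (simp add: path_matrix_def)

lemma ex_rule_path: "i < K \<Longrightarrow> \<exists>p. rule_path i p"
  using ex_undirected_walk[OF rule_graph(2,4,6,7)]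
    apath_cost_le[OF rule_graph(2), where \<omega>="\<lambda>_. 0"] by blast

lemma ex_rule_paths: "\<exists>P. \<forall>i<K. rule_path i (P i)"
  using ex_rule_path by metis

lemma finite_distance_matrices: "finite (distance_matrices S)"
proof (rule finite_subset)
  let ?F = "PiE {..<K} (\<lambda>i. {p. rule_path i p})"
  show "distance_matrices S \<subseteq> path_matrix ` ?F"
  proof
    fix D assume "D \<in> distance_matrices S"
    then obtain P where P: "D = path_matrix P" "\<forall>i<K. rule_path i (P i)"
      unfolding distance_matrices_eq by auto
    \<comment> \<open>Only the paths for the \<open>K\<close> colours enter the matrix, so choice
      functions restricted to these indices suffice, and there are finitely many of them.\<close>
    have "D = path_matrix (restrict P {..<K})"
      unfolding P(1) path_matrix_def by (intro cong_mat) auto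
    moreover have "restrict P {..<K} \<in> ?F" using P(2) by auto
    ultimately show "D \<in> path_matrix ` ?F" by blast
  qed
  have "finite {p. rule_path i p}" if "i < K" for i
    unfolding simple_path_def
    by (rule fin_digraph.apaths_finite[OF fin_undirected[OF rule_graph(1)[OF that]]])
  then show "finite (path_matrix ` ?F)" by (intro finite_imageI finite_PiE) auto
qed

lemma rule_path_awalk: "rule_path i p \<Longrightarrow> pre_digraph.awalk (undirected (R i)) (pos i) p (neg i)"
  by (simp add: simple_path_def pre_digraph.apath_def)

lemma rule_path_colour:
  assumes "i < K" "rule_path i p" "(e, d) \<in> set p"
  shows "col i e < K"
proof -
  have "e \<in> arcs (R i)" using rule_path_awalk[OF assms(2)] assms(3) by (auto simp: pre_digraph.awalk_def)
  then show ?thesis using rule_graph(5)[OF assms(1)] by blast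
qed

text \<open>Counting the arcs of a path by colour translates between matrix inequalities and path
  costs.\<close>

lemma path_matrix_row:
  assumes i: "i < K" and p: "rule_path i (P i)"
  shows "(\<Sum>j<K. real (path_matrix P $$ (i, j)) * u j) = walk_cost (\<lambda>e. u (col i e)) (P i)"
proof -
  have "(\<Sum>j<K. real (length (filter (\<lambda>(e, _). col i e = j) q)) * u j) = walk_cost (\<lambda>e. u (col i e)) q"
    if "\<forall>(e, d)\<in>set q. col i e < K" for q
    using that
  proof (induction q)
    case (Cons x q)
    obtain e d where x: "x = (e, d)" by (cases x)
    have "(\<Sum>j<K. real (length (filter (\<lambda>(e, _). col i e = j) (x # q))) * u j)
      = (\<Sum>j<K. (if j = col i e then u j else 0) + real (length (filter (\<lambda>(e, _). col i e = j) q)) * u j)"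
      by (intro sum.cong) (auto simp: x algebra_simps)
    also have "\<dots> = u (col i e) + walk_cost (\<lambda>e. u (col i e)) q"
      using Cons by (simp add: sum.distrib x)
    finally show ?case by (simp add: x)
  qed simp
  moreover have "\<forall>(e, d)\<in>set (P i). col i e < K" using rule_path_colour[OF i p] by auto
  ultimately show ?thesis using i by (simp add: path_matrix_def)
qed

text \<open>With one colour this is the distance assumption. With more colours, positivity of the
  distance matrices forces every path to use colours 0 and 1, hence two arcs.\<close>

lemma rule_path_length:
  assumes dp: "distance_positive S" and i: "i < K" and p: "rule_path i p"
  shows "2 \<le> length p"
proof (cases "K = 1")
  case True
  then have "i = 0" using i by simp
  interpret U: wf_digraph "undirected (R i)" by (rule wf_undirected[OF rule_graph(2)[OF i]])
  have "2 \<le> graph_dist (R i) (pos i) (neg i)"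
    using dp True \<open>i = 0\<close> by (simp add: distance_positive_def)
  also have "\<dots> \<le> ereal (U.awalk_cost (\<lambda>_. 1) p)"
    unfolding graph_dist_def by (rule U.min_cost_le_walk_cost[OF rule_path_awalk[OF p]])
  also have "\<dots> = ereal (real (length p))" by (simp add: U.awalk_cost_def sum_list_triv)
  finally show ?thesis by (simp add: numeral_eq_ereal)
next
  case False
  then have K: "0 < K" "1 < K" using i by auto
  obtain P where P: "\<forall>i<K. rule_path i (P i)" using ex_rule_paths by blast
  have "path_matrix (P(i := p)) \<in> distance_matrices S"
    unfolding distance_matrices_eq using P p by auto
  then have "positive_mat (path_matrix (P(i := p)))" using dp by (simp add: distance_positive_def)
  then have "0 < path_matrix (P(i := p)) $$ (i, j)" if "j < K" for j
    using i that path_matrix_carrier[of "P(i := p)"] unfolding positive_mat_def by auto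
  then have "filter (\<lambda>(e, _). col i e = j) p \<noteq> []" if "j < K" for j
    using i that by (simp add: path_matrix_def)
  then have "\<exists>x\<in>set p. col i (fst x) = j" if "j < K" for j
    using that by (simp add: filter_empty_conv case_prod_unfold)
  from this[OF K(1)] this[OF K(2)] obtain x y where
    x: "x \<in> set p" "col i (fst x) = 0" and y: "y \<in> set p" "col i (fst y) = 1" by blast
  then have "x \<noteq> y" by auto
  from x y have "card {x, y} \<le> card (set p)" by (intro card_mono) auto
  then show ?thesis using \<open>x \<noteq> y\<close> card_length[of p] by simp
qed

text \<open>Such an arc would form a simple path of length one.\<close>

lemma no_planting_arc:
  assumes dp: "distance_positive S" and i: "i < K" and e: "e \<in> arcs (R i)"
  shows "{tail (R i) e, head (R i) e} \<noteq> {pos i, neg i}"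
proof
  interpret U: wf_digraph "undirected (R i)" by (rule wf_undirected[OF rule_graph(2)[OF i]])
  assume "{tail (R i) e, head (R i) e} = {pos i, neg i}"
  then have "tail (R i) e = pos i \<and> head (R i) e = neg i \<or> head (R i) e = pos i \<and> tail (R i) e = neg i"
    by (auto simp: doubleton_eq_iff)
  moreover have "tail (R i) e \<in> verts (R i)" "head (R i) e \<in> verts (R i)"
    using rule_wf[OF i e] by auto
  ultimately have "rule_path i [(e, True)] \<or> rule_path i [(e, False)]"
    using e rule_graph(8)[OF i] by (elim disjE conjE) (simp_all add: simple_path_def U.apath_simps)
  then show False
    using rule_path_length[OF dp i, of "[(e, True)]"] rule_path_length[OF dp i, of "[(e, False)]"]
    by auto
qed

lemma ex_eigs_metric:
  assumes dp: "distance_positive S"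
  shows "\<exists>u. eigs_metric S u (rho_min (distance_matrices S))"
proof -
  let ?\<rho> = "rho_min (distance_matrices S)"
  have fin: "finite (rho ` distance_matrices S)" using finite_distance_matrices by simp
  have min_le: "?\<rho> \<le> rho D" if "D \<in> distance_matrices S" for D
    unfolding rho_min_def using fin that by (intro Min_le) auto
  have "distance_matrices S \<noteq> {}" unfolding distance_matrices_eq using ex_rule_paths by auto
  then have "?\<rho> \<in> rho ` distance_matrices S" unfolding rho_min_def using fin by (intro Min_in) auto
  then obtain P where P: "\<forall>i<K. rule_path i (P i)" "path_matrix P \<in> distance_matrices S"
    "?\<rho> = rho (path_matrix P)" unfolding distance_matrices_eq by auto
  have posD: "positive_mat D" if "D \<in> distance_matrices S" for D
    using dp that by (simp add: distance_positive_def)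
  obtain u where u: "\<And>i. i < K \<Longrightarrow> (0::real) < u i"
    "\<And>i. i < K \<Longrightarrow> (\<Sum>j<K. real (path_matrix P $$ (i, j)) * u j) = rho (path_matrix P) * u i"
    using primitive_perron_vector[OF path_matrix_carrier K_pos
        positive_mat_primitive[OF path_matrix_carrier posD[OF P(2)]]] by blast
  have cost: "walk_cost (\<lambda>e. u (col i e)) (P i) = ?\<rho> * u i" if "i < K" for i
    using u(2)[OF that] path_matrix_row[OF that, of P u] P that by simp
  have "?\<rho> * u i \<le> walk_cost (\<lambda>e. u (col i e)) p" if i: "i < K" and p: "rule_path i p" for i p
  proof (rule ccontr)
    assume less: "\<not> ?thesis"
    \<comment> \<open>Only row \<open>i\<close> changes: it becomes strictly smaller on
      \<open>u\<close>, while the other rows keep equality, so the spectral radius would drop below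
      its minimum.\<close>
    define Q where "Q = P(i := p)"
    have Q: "rule_path j (Q j)" if "j < K" for j using P(1) p that by (simp add: Q_def)
    then have D: "path_matrix Q \<in> distance_matrices S" unfolding distance_matrices_eq by auto
    have row: "(\<Sum>j<K. real (path_matrix Q $$ (k, j)) * u j) = walk_cost (\<lambda>e. u (col k e)) (Q k)"
      if "k < K" for k
      using that Q by (intro path_matrix_row)
    have "rho (path_matrix Q) < ?\<rho>"
    proof (rule rho_less_if_strictly_superinvariant[OF path_matrix_carrier K_pos posD[OF D],
          where z = u and h = i])
      show "(\<Sum>j<K. real (path_matrix Q $$ (k, j)) * u j) \<le> ?\<rho> * u k" if "k < K" for k
        unfolding row[OF that] using less cost[OF that] by (auto simp: Q_def)
      show "(\<Sum>j<K. real (path_matrix Q $$ (i, j)) * u j) < ?\<rho> * u i"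
        unfolding row[OF i] using less by (simp add: Q_def)
    qed (use u(1) i in auto)
    then show False using min_le[OF D] by simp
  qed
  moreover have "2 \<le> ?\<rho>"
  proof -
    \<comment> \<open>At an index of smallest weight, the chosen path has at least two arcs, each
      weighing at least \<open>u i\<close>.\<close>
    have "Min (u ` {..<K}) \<in> u ` {..<K}" using K_pos by (intro Min_in) auto
    then obtain i where i: "i < K" "u i = Min (u ` {..<K})" by auto
    have le: "u i \<le> u j" if "j < K" for j unfolding i(2) using that by (intro Min_le) auto
    have "2 * u i \<le> real (length (P i)) * u i"
      using rule_path_length[OF dp i(1)] P(1) i(1) u(1)[OF i(1)] by (intro mult_right_mono) auto
    also have "\<dots> = (\<Sum>_\<leftarrow>P i. u i)" by (simp add: sum_list_triv)
    also have "\<dots> \<le> walk_cost (\<lambda>e. u (col i e)) (P i)"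
      using rule_path_colour[OF i(1)] P(1) i(1) le by (intro sum_list_mono) auto
    also have "\<dots> = ?\<rho> * u i" by (rule cost[OF i(1)])
    finally show ?thesis using u(1)[OF i(1)] by simp
  qed
  ultimately have "eigs_metric S u ?\<rho>"
    using u(1) cost P(1) by unfold_locales auto
  then show ?thesis by (rule exI[of _ u])
qed

end

text \<open>Multiplicative constants disappear after taking logarithms and dividing by
  \<open>n\<close>.\<close>

lemma ln_growth:
  fixes x :: "nat \<Rightarrow> real"
  assumes ab: "0 < a" "0 < b" and s: "0 < s"
    and ev: "\<forall>\<^sub>F n in sequentially. a * s ^ n \<le> x n \<and> x n \<le> b * s ^ n"
  shows "(\<lambda>n. ln (x n) / real n) \<longlonglongrightarrow> ln s"
proof (rule tendsto_sandwich)
  show "(\<lambda>n. ln a / real n + ln s) \<longlonglongrightarrow> ln s" "(\<lambda>n. ln b / real n + ln s) \<longlonglongrightarrow> ln s"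
    using tendsto_add[OF lim_const_over_n tendsto_const] by simp_all
  have eq: "ln (c * s ^ n) / real n = ln c / real n + ln s" if "0 < n" "0 < c" for c n
    using that s by (simp add: ln_mult ln_realpow add_divide_distrib)
  show "\<forall>\<^sub>F n in sequentially. ln a / real n + ln s \<le> ln (x n) / real n"
    using ev eventually_gt_at_top[of 0]
  proof eventually_elim
    case (elim n)
    have "0 < a * s ^ n" using ab s by simp
    then have "ln (a * s ^ n) \<le> ln (x n)" using elim by simp
    then show ?case unfolding eq[OF elim(2) ab(1), symmetric] by (rule divide_right_mono) simp
  qed
  show "\<forall>\<^sub>F n in sequentially. ln (x n) / real n \<le> ln b / real n + ln s"
    using ev eventually_gt_at_top[of 0]
  proof eventually_elim
    case (elim n)
    have "0 < a * s ^ n" using ab s by simp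
    then have "ln (x n) \<le> ln (b * s ^ n)" using elim by simp
    then show ?case unfolding eq[OF elim(2) ab(2), symmetric] by (rule divide_right_mono) simp
  qed
qed

section \<open>Growth of balls and the limit\<close>

context eigs_system begin

lemma graph_ball_growth:
  assumes dp: "distance_positive S" and prim: "primitive_mat (degree_matrix S)"
    and s: "1 < rho (degree_matrix S)" and v: "v \<in> Xi_verts S" and r: "1 < r"
  shows "\<exists>a>0. \<exists>b>0. \<forall>\<^sub>F n in sequentially.
    a * rho (degree_matrix S) ^ n \<le> real (card (graph_ball (G n) v r)) \<and>
    real (card (graph_ball (G n) v r)) \<le> b * rho (degree_matrix S) ^ n"
proof -
  let ?s = "rho (degree_matrix S)"
  obtain u where "eigs_metric S u (rho_min (distance_matrices S))" using ex_eigs_metric[OF dp] by blast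
  then interpret eigs_metric S u "rho_min (distance_matrices S)" .
  let ?\<rho> = "rho_min (distance_matrices S)"
  have "0 < 2 * K" using K_pos by simp
  then obtain y where y: "\<And>c. c < 2 * K \<Longrightarrow> (0::real) < y c"
    "\<And>c. c < 2 * K \<Longrightarrow> (\<Sum>j<2 * K. real (degree_matrix S $$ (c, j)) * y j) = ?s * y c"
    using primitive_perron_vector[OF degree_matrix_carrier _ prim] by blast
  define l where "l = Min (y ` {..<2 * K})"
  define h where "h = Max (y ` {..<2 * K})"
  have lh: "l \<le> y c \<and> y c \<le> h" if "c < 2 * K" for c
    unfolding l_def h_def using that by auto
  have l: "0 < l" unfolding l_def using y(1) \<open>0 < 2 * K\<close>
    by (subst Min_gr_iff) (auto simp: lessThan_empty_iff)
  have h: "0 < h" using l lh[OF \<open>0 < 2 * K\<close>] by linarith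
  have deg: "l * card (incident n v) \<le> weighted_degree y n v"
    "weighted_degree y n v \<le> 2 * h * card (incident n v)" for n
    using weighted_degree_bounds[of l y h n v] lh l by auto
  obtain m where m: "v \<in> verts (G m)" using v by (auto simp: Xi_verts_def)
  define W where "W = weighted_degree y m v"
  have "0 < card (incident m v)"
    using incident_nonempty[OF m] finite_incident by (simp add: card_gt_0_iff)
  then have W: "0 < W" using deg(1)[of m] l unfolding W_def
    by (smt (verit) mult_pos_pos of_nat_0_less_iff)
  have Wk: "weighted_degree y (m + k) v = ?s ^ k * W" for k
  proof (induction k)
    case (Suc k)
    then show ?case using weighted_degree_Suc[OF y(2), of v "m + k"] verts_mono[of m "m + k"] m
      by auto
  qed (simp add: W_def)
  \<comment> \<open>The number of levels to go back depends on the radius, but not on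
    \<open>n\<close>.\<close>
  obtain L where "r * u_max / u_min < ?\<rho> ^ L"
    using real_arch_pow[of ?\<rho> "r * u_max / u_min"] rho_ge_2 by auto
  then have L: "r * u_max \<le> ?\<rho> ^ L * u_min" using u_min_pos by (simp add: field_simps)
  define M where "M = real arc_bound ^ L"
  \<comment> \<open>Balls of level \<open>n\<close> are compared with degrees of level
    \<open>n - 1\<close>, hence \<open>Suc m\<close>; the factor \<open>2 * h\<close> converts a
    weighted degree into a number of arcs.\<close>
  define a where "a = W / (2 * h * ?s ^ Suc m)"
  \<comment> \<open>The summand 1 pays for the centre of the ball.\<close>
  define b where "b = 1 + 2 * M * W / l"
  have "0 < a" "0 < b" unfolding a_def b_def M_def using W h l s by (auto intro!: add_pos_nonneg)
  moreover have "a * ?s ^ n \<le> real (card (graph_ball (G n) v r))" if "Suc m \<le> n" for n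
  proof -
    define k where "k = n - Suc m"
    have n: "n = Suc (m + k)" using that by (simp add: k_def)
    have "?s ^ k * W \<le> 2 * h * card (incident (m + k) v)" using deg(2)[of "m + k"] by (simp add: Wk)
    then have "?s ^ k * W / (2 * h) \<le> card (incident (m + k) v)" using h by (simp add: field_simps)
    also have "\<dots> \<le> card (graph_ball (G n) v r)"
      unfolding n using verts_mono[of m "m + k"] m
      by (intro of_nat_mono card_incident_le_ball[OF _ r no_planting_arc[OF dp]]) auto
    also have "?s ^ k * W / (2 * h) = a * ?s ^ n"
      using s h by (simp add: a_def n power_add)
    finally show ?thesis .
  qed
  moreover have "real (card (graph_ball (G n) v r)) \<le> b * ?s ^ n" if "m + L \<le> n" for n
  proof -
    define k where "k = n - (m + L)"
    have n: "n = (m + k) + L" using that by (simp add: k_def)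
    have "l * card (incident (m + k) v) \<le> ?s ^ k * W" using deg(1)[of "m + k"] by (simp add: Wk)
    then have I: "card (incident (m + k) v) \<le> ?s ^ k * W / l" using l by (simp add: field_simps)
    have "real (card (graph_ball (G n) v r)) \<le> real (1 + 2 * (arc_bound ^ L * card (incident (m + k) v)))"
      unfolding n using verts_mono[of m "m + k"] m
      by (intro of_nat_mono card_graph_ball_le[OF _ L]) auto
    also have "\<dots> = 1 + 2 * M * card (incident (m + k) v)" by (simp add: M_def)
    also have "\<dots> \<le> 1 + 2 * M * (?s ^ k * W / l)"
      using I by (intro add_left_mono mult_left_mono) (auto simp: M_def)
    also have "\<dots> = 1 + (2 * M * W / l) * ?s ^ k" by simp
    also have "\<dots> \<le> ?s ^ n + (2 * M * W / l) * ?s ^ n"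
    proof (rule add_mono)
      show "1 \<le> ?s ^ n" using s by (simp add: one_le_power)
      show "2 * M * W / l * ?s ^ k \<le> 2 * M * W / l * ?s ^ n"
        using s W l by (intro mult_left_mono power_increasing) (simp_all add: M_def n)
    qed
    also have "\<dots> = b * ?s ^ n" by (simp add: b_def algebra_simps)
    finally show ?thesis .
  qed
  ultimately show ?thesis
    by (intro exI[of _ a] exI[of _ b] conjI) (auto intro!: eventually_sequentiallyI[of "Suc m + L"])
qed

lemma local_mass_dim_limit:
  assumes dp: "distance_positive S" and prim: "primitive_mat (degree_matrix S)"
    and s: "1 < rho (degree_matrix S)" and v: "v \<in> Xi_verts S"
  shows "has_local_mass_dim G v (ln (rho (degree_matrix S)) / ln (rho_min (distance_matrices S)))"
  unfolding has_local_mass_dim_def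
proof (intro allI impI)
  fix r :: real assume r: "1 < r"
  let ?s = "rho (degree_matrix S)" and ?\<rho> = "rho_min (distance_matrices S)"
  obtain u where "eigs_metric S u ?\<rho>" using ex_eigs_metric[OF dp] by blast
  then interpret eigs_metric S u ?\<rho> .
  let ?x = "\<lambda>n. real (card (graph_ball (G n) v r))" and ?d = "\<lambda>n. graph_diam (G n)"
  obtain a b where ab: "0 < a" "0 < b"
    "\<forall>\<^sub>F n in sequentially. a * ?s ^ n \<le> ?x n \<and> ?x n \<le> b * ?s ^ n"
    using graph_ball_growth[OF dp prim s v r] by blast
  have x: "(\<lambda>n. ln (?x n) / real n) \<longlonglongrightarrow> ln ?s" using ab s by (intro ln_growth) auto
  obtain a' b' where ab': "0 < a'" "0 < b'" "\<And>n. a' * ?\<rho> ^ n \<le> ?d n" "\<And>n. ?d n \<le> b' * ?\<rho> ^ n"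
    using graph_diam_bounds by blast
  \<comment> \<open>The radius only changes the constants, so the limit does not depend on
    it.\<close>
  have "a' / r * ?\<rho> ^ n \<le> ?d n / r \<and> ?d n / r \<le> b' / r * ?\<rho> ^ n" for n
    using ab'(3,4)[of n] r by (simp add: divide_right_mono)
  then have "(\<lambda>n. ln (?d n / r) / real n) \<longlonglongrightarrow> ln ?\<rho>"
    by (intro ln_growth[of "a' / r" "b' / r"] always_eventually allI)
      (use ab'(1,2) r rho_ge_2 in auto)
  then have "(\<lambda>n. (ln (?x n) / real n) / (ln (?d n / r) / real n)) \<longlonglongrightarrow> ln ?s / ln ?\<rho>"
    using x rho_ge_2 by (intro tendsto_divide) auto
  moreover have "\<forall>\<^sub>F n in sequentially. (ln (?x n) / real n) / (ln (?d n / r) / real n)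
    = ln (?x n) / (- ln (r / ?d n))"
    using eventually_gt_at_top[of 0]
  proof eventually_elim
    case (elim n)
    \<comment> \<open>Positivity of the diameter allows the logarithm of the quotient to be
      inverted.\<close>
    have "0 < a' * ?\<rho> ^ n" using ab'(1) rho_ge_2 by simp
    then have "0 < ?d n" using ab'(3)[of n] by linarith
    then have "- ln (r / ?d n) = ln (?d n / r)" using r by (simp add: ln_div)
    then show ?case using elim by simp
  qed
  ultimately show "(\<lambda>n. ln (?x n) / (- ln (r / ?d n))) \<longlonglongrightarrow> ln ?s / ln ?\<rho>"
    by (rule Lim_transform_eventually)
qed

end

text \<open>A single admissible radius, here 2, determines the value by uniqueness of
  limits.\<close>

lemma local_mass_dim_eqI:
  assumes "has_local_mass_dim G v d"
  shows "local_mass_dim G v = d"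
  unfolding local_mass_dim_def
proof (rule the_equality[of "has_local_mass_dim G v", OF assms])
  fix d' assume d': "has_local_mass_dim G v d'"
  from d' assms show "d' = d"
    unfolding has_local_mass_dim_def by (intro LIMSEQ_unique) (erule allE[of _ 2], simp)+
qed

theorem proposition2p16:
  fixes S :: "('v, 'e) eigs" and v :: "('v, 'e) eigs_vertex"
  assumes "valid_eigs S"
    and "canonical S"
    and "distance_positive S"
    and "primitive_mat (degree_matrix S)"
    and "v \<in> Xi_verts S"
    and "rho (degree_matrix S) > 1"
  shows "local_mass_dim_exists (Xi_graph S) v \<and>
    local_mass_dim (Xi_graph S) v =
      ln (rho (degree_matrix S)) / ln (rho_min (distance_matrices S))"
proof -
  interpret eigs_system S by unfold_locales (rule assms(1))
  from local_mass_dim_limit[OF assms(3,4,6,5)] show ?thesis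
    unfolding local_mass_dim_exists_def by (intro conjI exI local_mass_dim_eqI)
qed

end
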